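(* Let $p$ be a prime. (a) Let $n\ge 1$ be an integer. The simplicial complex $X(\mathbb{F}_p^n)$ is homotopy equivalent to the wedge of $A_n(p)$ spheres $S^{n-1}$, where $$A_n(p)=(-1)^n+\sum_{i=0}^{n-1}(-1)^{n-1-i}\frac{(p^n-p^{i})\cdots(p^n-p^0)}{(i+1)!}.$$ (b) Let $n>1$ be an integer. The simplicial complex $K(\mathbb{F}_p^n)$ is homotopy equivalent to the wedge of $B_n(p)$ spheres $S^{n-1}$, where $$B_n(p)=(-1)^n+\sum_{i=0}^{n-1}(-1)^{n-1-i}\frac{(p^n-p^{i})\cdots(p^n-p^0)}{(p-1)^{i+1}\,(i+1)!}.$$
   Context: $X(\mathbb{F}_p^n)$ is the simplicial complex whose vertices are the nonzero vectors of $\mathbb{F}_p^n$ and whose simplices are the linearly independent subsets of $\mathbb{F}_p^n$. $K(\mathbb{F}_p^n)$ is the simplicial complex whose vertices are the $1$-dimensional subspaces (lines) of $\mathbb{F}_p^n$ and whose simplices are the sets of lines $\{l_1,\dots,l_k\}$ spanning a $k$-dimensional subspace. Homotopy equivalence refers to geometric realizations; a wedge of $0$ spheres is a point. *)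

theory Defs
  imports "HOL-Analysis.Analysis" "Berlekamp_Zassenhaus.Finite_Field"
begin

subsection \<open>Geometric realization\<close>

text \<open>
  A simplicial complex is given by its set of simplices; the empty simplex may belong to this set
  and contributes nothing to the realization. Points of the realization are given by barycentric
  coordinates. The topology is that of pointwise convergence, which agrees with the weak topology
  when the complex is finite; only finite complexes are considered here.
\<close>

definition geometric_realization :: "'v set set \<Rightarrow> ('v \<Rightarrow> real) topology" where
  "geometric_realization K =
     subtopology (powertop_real UNIV)
       {a. (\<forall>v. 0 \<le> a v) \<and> {v. a v \<noteq> 0} \<in> K \<and> (\<Sum>v | a v \<noteq> 0. a v) = 1}"


subsection \<open>Wedge of pointed spaces\<close>

text \<open>
  The quotient of the disjoint union of the spaces \<open>X i\<close> that identifies all base points \<open>b i\<close>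
  to one point, \<open>None\<close>. This point is present even when \<open>I\<close> is empty, so the empty wedge is a point.
\<close>

definition wedge_proj :: "('i \<Rightarrow> 'a) \<Rightarrow> 'i \<times> 'a \<Rightarrow> ('i \<times> 'a) option" where
  "wedge_proj b = (\<lambda>(i, x). if x = b i then None else Some (i, x))"

definition wedge :: "('i \<Rightarrow> 'a topology) \<Rightarrow> ('i \<Rightarrow> 'a) \<Rightarrow> 'i set \<Rightarrow> ('i \<times> 'a) option topology" where
  "wedge X b I =
     topology (\<lambda>U. U \<subseteq> insert None (wedge_proj b ` topspace (sum_topology X I)) \<and>
                   openin (sum_topology X I)
                     {z \<in> topspace (sum_topology X I). wedge_proj b z \<in> U})"

lemma openin_wedge:
  "openin (wedge X b I) U \<longleftrightarrow>
     U \<subseteq> insert None (wedge_proj b ` topspace (sum_topology X I)) \<and>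
     openin (sum_topology X I) {z \<in> topspace (sum_topology X I). wedge_proj b z \<in> U}"
proof -
  let ?S = "sum_topology X I"
  let ?V = "\<lambda>U. {z \<in> topspace ?S. wedge_proj b z \<in> U}"
  let ?P = "\<lambda>U. U \<subseteq> insert None (wedge_proj b ` topspace ?S) \<and> openin ?S (?V U)"
  have "istopology ?P"
    unfolding istopology_def
  proof (intro conjI allI impI)
    fix U W assume "?P U" "?P W"
    moreover have "?V (U \<inter> W) = ?V U \<inter> ?V W" by auto
    ultimately show "U \<inter> W \<subseteq> insert None (wedge_proj b ` topspace ?S)" "openin ?S (?V (U \<inter> W))"
      by auto
  next
    fix \<U> assume *: "\<forall>U\<in>\<U>. ?P U"
    have "?V (\<Union>\<U>) = \<Union> (?V ` \<U>)" by auto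
    then show "openin ?S (?V (\<Union>\<U>))" using * by (metis (no_types, lifting) imageE openin_Union)
    show "\<Union>\<U> \<subseteq> insert None (wedge_proj b ` topspace ?S)" using * by blast
  qed
  then show ?thesis by (simp add: wedge_def topology_inverse')
qed

definition wedge_of_spheres :: "nat \<Rightarrow> nat \<Rightarrow> (nat \<times> (nat \<Rightarrow> real)) option topology" where
  "wedge_of_spheres m d = wedge (\<lambda>_. nsphere d) (\<lambda>_ j. if j = 0 then 1 else 0) {..<m}"


subsection \<open>The complexes of independent vectors and of independent lines\<close>

text \<open>The vertices of \<open>X_complex\<close> are the nonzero vectors, as \<open>{v}\<close> is independent iff \<open>v \<noteq> 0\<close>.\<close>

definition X_complex :: "('k::field ^ 'n) set set" where
  "X_complex = {S. vec.independent S}"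

definition lines :: "('k::field ^ 'n) set set" where
  "lines = {l. vec.subspace l \<and> vec.dim l = 1}"

definition K_complex :: "('k::field ^ 'n) set set set" where
  "K_complex = {L. L \<subseteq> lines \<and> finite L \<and> vec.dim (vec.span (\<Union>L)) = card L}"


subsection \<open>The numbers of spheres\<close>

definition A_number :: "nat \<Rightarrow> nat \<Rightarrow> real" where
  "A_number n p = (-1) ^ n +
     (\<Sum>i<n. (-1) ^ (n - 1 - i) * (\<Prod>j\<le>i. real p ^ n - real p ^ j) / fact (i + 1))"

definition B_number :: "nat \<Rightarrow> nat \<Rightarrow> real" where
  "B_number n p = (-1) ^ n +
     (\<Sum>i<n. (-1) ^ (n - 1 - i) * (\<Prod>j\<le>i. real p ^ n - real p ^ j) /
             ((real p - 1) ^ (i + 1) * fact (i + 1)))"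

end

theory Submission
  imports Defs
begin

text \<open>
  Both complexes are independence complexes of matroids of rank \<open>n\<close> (for \<open>K\<close>, choose a vector on
  every line). By deletion and contraction of an element, an independence complex \<open>I\<close> contains a set
  \<open>H\<close> of bases such that \<open>I - H\<close> collapses to the empty family. Hence \<open>I - H\<close> is contractible, it
  contains the boundaries of all simplices in \<open>H\<close>, and collapsing it to a point turns the
  realization of \<open>I\<close> into a wedge of spheres indexed by \<open>H\<close>. As every collapse removes two faces of
  opposite parity, \<open>card H\<close> is up to sign the reduced Euler characteristic of \<open>I\<close>, which is computed
  from the number of ways to extend an independent set by one element.
\<close>

subsection \<open>Collapsing a contractible subspace\<close>

text \<open>The induction hinges on the gluing: every face of the contraction has fewer than
  \<open>r\<close> elements, so the contraction avoids the bases removed from the deletion, and what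
  survives of its cone can be attached to what survives of the deletion. Collapsing a contractible
  subspace is a homotopy equivalence by homotopy extension, so the contraction of the subcomplex
  gets an explicit extension formula that acts inside the removed facets. As the target is a
  concrete wedge of round spheres, the quotient also needs explicit coordinates: each removed facet
  is mapped onto its sphere, everything else to the base point. Maps out of the wedge are continuous
  as soon as their pullbacks are, because a continuous surjection from a compact space onto a
  Hausdorff space is a quotient map. Only the number of removed bases is determined, never the bases
  themselves; being a cardinality, it shows that both alternating sums are natural numbers.\<close>

lemma homotopy_equivalent_collapse:
  fixes X :: "'a topology" and W :: "'b topology"
  assumes X: "compact_space X" and W: "Hausdorff_space W"
    and f: "continuous_map X W f" "f ` topspace X = topspace W"
    and A: "A \<subseteq> topspace X" "\<And>x. x \<in> A \<Longrightarrow> f x = w"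
    and inj: "\<And>x y. x \<in> topspace X \<Longrightarrow> y \<in> topspace X \<Longrightarrow> f x = f y \<Longrightarrow> x = y \<or> x \<in> A \<and> y \<in> A"
    and h: "continuous_map (prod_topology (top_of_set {0..1::real}) X) X h"
    and h0: "\<And>x. x \<in> topspace X \<Longrightarrow> h (0, x) = x"
    and hA: "\<And>t x. t \<in> {0..1} \<Longrightarrow> x \<in> A \<Longrightarrow> h (t, x) \<in> A"
    and h1: "\<And>x. x \<in> A \<Longrightarrow> h (1, x) = x0"
  shows "X homotopy_equivalent_space W"
proof -
  let ?I = "top_of_set {0..1::real}"
  \<comment> \<open>Descending the homotopy \<open>h\<close> to \<open>W\<close> requires that the
    product of the interval with \<open>f\<close> is again a quotient map; compactness and the
    Hausdorff property survive the product.\<close>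
  define F where "F = (\<lambda>(t::real, x). (t, f x))"
  have fX: "f x \<in> topspace W" if "x \<in> topspace X" for x using f that by blast
  have q: "quotient_map X W f" by (rule continuous_imp_quotient_map[OF f(1) X W f(2)])
  have "continuous_map (prod_topology ?I X) (prod_topology ?I W) F"
    unfolding F_def using f(1)
    by (simp add: continuous_map_prod_top)
  moreover have "compact_space (prod_topology ?I X)"
    using X by (simp add: compact_space_prod_topology compact_space_subtopology)
  moreover have "Hausdorff_space (prod_topology ?I W)"
    using W by (simp add: Hausdorff_space_prod_topology Hausdorff_space_subtopology)
  moreover have "F ` topspace (prod_topology ?I X) = topspace (prod_topology ?I W)"
  proof -
    have "F ` (A' \<times> B) = A' \<times> f ` B" for A' B by (auto simp: F_def)
    then show ?thesis using f(2) by simp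
  qed
  ultimately have qF: "quotient_map (prod_topology ?I X) (prod_topology ?I W) F"
    by (rule continuous_imp_quotient_map)
  \<comment> \<open>\<open>s\<close> is a section without any continuity. It undoes \<open>f\<close>
    except on \<open>A\<close>, where the ambiguity is harmless: \<open>h (1, _)\<close> is constant
    on \<open>A\<close>, and \<open>f\<close> is constant on \<open>h (t, _)\<close> of
    \<open>A\<close>. So the homotopy inverse \<open>g\<close> and the homotopy \<open>k\<close> do
    not depend on the choice.\<close>
  define s where "s y = (SOME x. x \<in> topspace X \<and> f x = y)" for y
  have s: "s y \<in> topspace X \<and> f (s y) = y" if "y \<in> topspace W" for y
  proof -
    have "y \<in> f ` topspace X" using that f(2) by simp
    then have "\<exists>x. x \<in> topspace X \<and> f x = y" by (auto simp: image_iff)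
    then show ?thesis unfolding s_def by (rule someI_ex)
  qed
  have sf: "s (f x) = x \<or> s (f x) \<in> A \<and> x \<in> A" if "x \<in> topspace X" for x
    using inj[OF _ that] s[OF fX[OF that]] by blast
  define g where "g y = h (1, s y)" for y
  define k where "k = (\<lambda>(t, y). f (h (t, s y)))"
  have gf: "g (f x) = h (1, x)" if "x \<in> topspace X" for x
    using sf[OF that] h1 unfolding g_def by auto
  have h1c: "continuous_map X X (\<lambda>x. h (1, x))"
  proof -
    have "continuous_map X (prod_topology ?I X) (\<lambda>x. (1, x))"
      by (simp add: continuous_map_pairwise o_def)
    then show ?thesis using continuous_map_compose[OF _ h] by (simp add: o_def)
  qed
  have g: "continuous_map W X g"
    by (rule continuous_compose_quotient_map[OF q])
       (rule continuous_map_eq[OF h1c], simp add: gf)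
  have "continuous_map (prod_topology ?I X) W (f \<circ> h)"
    using h f(1) by (rule continuous_map_compose)
  then have "continuous_map (prod_topology ?I X) W (k \<circ> F)"
  proof (rule continuous_map_eq)
    fix z assume "z \<in> topspace (prod_topology ?I X)"
    then obtain t x where z: "z = (t, x)" "t \<in> {0..1}" "x \<in> topspace X" by auto
    then show "(f \<circ> h) z = (k \<circ> F) z"
      using sf[of x] hA[of t] A(2) by (auto simp: k_def F_def)
  qed
  then have k: "continuous_map (prod_topology ?I W) W k"
    by (rule continuous_compose_quotient_map[OF qF])
  have "homotopic_with (\<lambda>x. True) X X id (g \<circ> f)"
    unfolding homotopic_with[where P = "\<lambda>x. True", OF refl]
    using h h0 gf by (intro exI[of _ h]) auto
  moreover have "homotopic_with (\<lambda>x. True) W W id (f \<circ> g)"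
    unfolding homotopic_with[where P = "\<lambda>x. True", OF refl]
    using k s h0 by (intro exI[of _ k]) (auto simp: k_def g_def)
  ultimately show ?thesis
    unfolding homotopy_equivalent_space_def
    using f(1) g by (auto intro!: exI[of _ f] exI[of _ g] simp: homotopic_with_sym[of _ _ _ id])
qed

section \<open>The topology of a wedge\<close>

lemma topspace_wedge:
  "topspace (wedge X b I) = insert None (wedge_proj b ` topspace (sum_topology X I))"
proof (rule antisym)
  show "topspace (wedge X b I) \<subseteq> insert None (wedge_proj b ` topspace (sum_topology X I))"
    using openin_topspace[of "wedge X b I"] unfolding openin_wedge by blast
  have "{z \<in> topspace (sum_topology X I). wedge_proj b z \<in> insert None (wedge_proj b ` topspace (sum_topology X I))}
      = topspace (sum_topology X I)" by blast
  then have "openin (wedge X b I) (insert None (wedge_proj b ` topspace (sum_topology X I)))"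
    unfolding openin_wedge by (metis openin_topspace order_refl)
  then show "insert None (wedge_proj b ` topspace (sum_topology X I)) \<subseteq> topspace (wedge X b I)"
    by (rule openin_subset)
qed

lemma openin_wedge_iff:
  "openin (wedge X b I) U \<longleftrightarrow> U \<subseteq> topspace (wedge X b I) \<and>
     (\<forall>i\<in>I. openin (X i) {x \<in> topspace (X i). wedge_proj b (i, x) \<in> U})"
proof -
  have "{x. (i, x) \<in> {z \<in> topspace (sum_topology X I). wedge_proj b z \<in> U}}
      = {x \<in> topspace (X i). wedge_proj b (i, x) \<in> U}" if "i \<in> I" for i
    using that by simp
  then have "openin (sum_topology X I) {z \<in> topspace (sum_topology X I). wedge_proj b z \<in> U} \<longleftrightarrow>
      (\<forall>i\<in>I. openin (X i) {x \<in> topspace (X i). wedge_proj b (i, x) \<in> U})"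
    unfolding openin_sum_topology by auto
  then show ?thesis unfolding openin_wedge topspace_wedge by (simp only:)
qed

text \<open>The maps \<open>g i\<close> keep the summand \<open>i\<close> and send all others to the
  base point \<open>b i\<close>. They are continuous and jointly separate points, so disjoint
  neighbourhoods can be pulled back from one summand.\<close>

lemma Hausdorff_space_wedge:
  assumes H: "\<And>i. i \<in> I \<Longrightarrow> Hausdorff_space (X i)" and b: "\<And>i. i \<in> I \<Longrightarrow> b i \<in> topspace (X i)"
  shows "Hausdorff_space (wedge X b I)"
proof -
  define g where "g i w = (case w of None \<Rightarrow> b i | Some (j, x) \<Rightarrow> if j = i then x else b i)" for i w
  have proj: "g i (wedge_proj b (j, x)) = (if j = i then x else b i)" for i j x
    by (auto simp: g_def wedge_proj_def)
  have top: "w = None \<or> (\<exists>i\<in>I. \<exists>x\<in>topspace (X i). x \<noteq> b i \<and> w = Some (i, x))"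
    if "w \<in> topspace (wedge X b I)" for w
    using that unfolding topspace_wedge by (auto simp: wedge_proj_def split: if_splits)
  have gt: "g i w \<in> topspace (X i)" if "i \<in> I" "w \<in> topspace (wedge X b I)" for i w
    using top[OF that(2)] b[OF that(1)] by (auto simp: g_def)
  have cont: "continuous_map (wedge X b I) (X i) (g i)" if i: "i \<in> I" for i
    unfolding continuous_map_def
  proof (intro conjI allI impI)
    fix V assume V: "openin (X i) V"
    show "openin (wedge X b I) {w \<in> topspace (wedge X b I). g i w \<in> V}"
      unfolding openin_wedge_iff
    proof (intro conjI ballI)
      fix j assume j: "j \<in> I"
      have *: "wedge_proj b (j, x) \<in> topspace (wedge X b I)" if "x \<in> topspace (X j)" for x
        using j that unfolding topspace_wedge by auto
      have "{x \<in> topspace (X j). wedge_proj b (j, x) \<in> {w \<in> topspace (wedge X b I). g i w \<in> V}}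
          = (if j = i then V else if b i \<in> V then topspace (X j) else {})"
        using * openin_subset[OF V] by (auto simp: proj)
      then show "openin (X j) {x \<in> topspace (X j). wedge_proj b (j, x) \<in> {w \<in> topspace (wedge X b I). g i w \<in> V}}"
        using V by auto
    qed auto
  qed (use gt i in auto)
  show ?thesis
    unfolding Hausdorff_space_def
  proof (intro allI impI)
    fix v w assume vw: "v \<in> topspace (wedge X b I) \<and> w \<in> topspace (wedge X b I) \<and> v \<noteq> w"
    then obtain i where i: "i \<in> I" "g i v \<noteq> g i w"
      using top[of v] top[of w] unfolding g_def by (auto split: if_splits) (metis+)?
    then obtain U V where "openin (X i) U" "openin (X i) V" "g i v \<in> U" "g i w \<in> V" "disjnt U V"
      using H[OF i(1)] gt vw unfolding Hausdorff_space_def by meson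
    then show "\<exists>U V. openin (wedge X b I) U \<and> openin (wedge X b I) V \<and> v \<in> U \<and> w \<in> V \<and> disjnt U V"
      using vw openin_continuous_map_preimage[OF cont[OF i(1)]]
      by (intro exI[of _ "{x \<in> topspace (wedge X b I). g i x \<in> U}"]
            exI[of _ "{x \<in> topspace (wedge X b I). g i x \<in> V}"]) (auto simp: disjnt_iff)
  qed
qed

text \<open>At most one \<open>q i a\<close> differs from its base point, since two such indices
  would give \<open>f a\<close> two values. The preimage of an open set is the union of the sets
  \<open>V i\<close> if the set omits \<open>None\<close>, and their intersection otherwise; the
  intersection is where finiteness of \<open>I\<close> enters.\<close>

lemma continuous_map_into_wedge:
  assumes I: "finite I" and q: "\<And>i. i \<in> I \<Longrightarrow> continuous_map T (X i) (q i)"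
    and b: "\<And>i. i \<in> I \<Longrightarrow> b i \<in> topspace (X i)"
    and Some: "\<And>i a. a \<in> topspace T \<Longrightarrow> i \<in> I \<Longrightarrow> q i a \<noteq> b i \<Longrightarrow> f a = Some (i, q i a)"
    and None: "\<And>a. a \<in> topspace T \<Longrightarrow> (\<And>i. i \<in> I \<Longrightarrow> q i a = b i) \<Longrightarrow> f a = None"
  shows "continuous_map T (wedge X b I) f"
  unfolding continuous_map_def
proof (intro conjI allI impI)
  have qt: "q i a \<in> topspace (X i)" if "i \<in> I" "a \<in> topspace T" for i a
    using q[OF that(1)] that(2) by (auto simp: continuous_map_def)
  have cases: "(\<forall>i\<in>I. q i a = b i) \<and> f a = None \<or>
      (\<exists>i\<in>I. q i a \<noteq> b i \<and> f a = Some (i, q i a) \<and> (\<forall>j\<in>I. j \<noteq> i \<longrightarrow> q j a = b j))"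
    if a: "a \<in> topspace T" for a
  proof (cases "\<forall>i\<in>I. q i a = b i")
    case False
    then obtain i where i: "i \<in> I" "q i a \<noteq> b i" by blast
    have "q j a = b j" if "j \<in> I" "j \<noteq> i" for j
      using Some[OF a i] Some[OF a that(1)] that(2) by auto
    then show ?thesis using Some[OF a i] i by blast
  qed (use None a in blast)
  show "f \<in> topspace T \<rightarrow> topspace (wedge X b I)"
  proof
    fix a assume a: "a \<in> topspace T"
    from cases[OF a] show "f a \<in> topspace (wedge X b I)"
    proof
      assume "\<exists>i\<in>I. q i a \<noteq> b i \<and> f a = Some (i, q i a) \<and> (\<forall>j\<in>I. j \<noteq> i \<longrightarrow> q j a = b j)"
      then obtain i where i: "i \<in> I" "q i a \<noteq> b i" "f a = Some (i, q i a)" by blast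
      then have "f a = wedge_proj b (i, q i a)" by (simp add: wedge_proj_def)
      then show ?thesis using qt[OF i(1) a] i(1) unfolding topspace_wedge by auto
    qed (simp add: topspace_wedge)
  qed
  fix U assume U: "openin (wedge X b I) U"
  define V where "V i = {a \<in> topspace T. q i a \<in> {x \<in> topspace (X i). wedge_proj b (i, x) \<in> U}}" for i
  have V: "openin T (V i)" if "i \<in> I" for i
    unfolding V_def
    by (rule openin_continuous_map_preimage[OF q[OF that]]) (use U that in \<open>simp add: openin_wedge_iff\<close>)
  have Vi: "a \<in> V i \<longleftrightarrow> a \<in> topspace T \<and> (if q i a = b i then None \<in> U else Some (i, q i a) \<in> U)"
    if "i \<in> I" for i a
    using qt[OF that] b[OF that] by (auto simp: V_def wedge_proj_def)
  show "openin T {a \<in> topspace T. f a \<in> U}"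
  proof (cases "None \<in> U")
    case True
    have "f a \<in> U \<longleftrightarrow> (\<forall>i\<in>I. a \<in> V i)" if a: "a \<in> topspace T" for a
    proof
      assume fa: "f a \<in> U"
      show "\<forall>i\<in>I. a \<in> V i"
      proof
        fix i assume i: "i \<in> I"
        show "a \<in> V i"
          using Vi[OF i, of a] Some[OF a i] fa True a by (cases "q i a = b i") auto
      qed
    next
      assume *: "\<forall>i\<in>I. a \<in> V i"
      from cases[OF a] show "f a \<in> U"
      proof
        assume "\<exists>i\<in>I. q i a \<noteq> b i \<and> f a = Some (i, q i a) \<and> (\<forall>j\<in>I. j \<noteq> i \<longrightarrow> q j a = b j)"
        then obtain i where i: "i \<in> I" "q i a \<noteq> b i" "f a = Some (i, q i a)" by blast
        then show ?thesis using Vi[OF i(1), of a] * by simp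
      qed (simp add: True)
    qed
    then have "{a \<in> topspace T. f a \<in> U} = topspace T \<inter> (\<Inter>i\<in>I. V i)" by auto
    moreover have "openin T (topspace T \<inter> (\<Inter>i\<in>I. V i))"
      using openin_INT[OF I, of T V] V by (simp add: Int_commute)
    ultimately show ?thesis by simp
  next
    case False
    have "{a \<in> topspace T. f a \<in> U} = (\<Union>i\<in>I. V i)"
    proof (intro equalityI subsetI)
      fix a assume a: "a \<in> {a \<in> topspace T. f a \<in> U}"
      then obtain i where i: "i \<in> I" "q i a \<noteq> b i" "f a = Some (i, q i a)"
        using cases[of a] False by force
      then have "a \<in> V i" using Vi[OF i(1), of a] a by simp
      then show "a \<in> (\<Union>i\<in>I. V i)" using i(1) by blast
    next
      fix a assume a: "a \<in> (\<Union>i\<in>I. V i)"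
      then obtain i where i: "i \<in> I" "a \<in> V i" by blast
      then show "a \<in> {a \<in> topspace T. f a \<in> U}"
        using Vi[OF i(1)] Some[OF _ i(1)] False by (auto split: if_splits)
    qed
    moreover have "openin T (\<Union>i\<in>I. V i)" using V by blast
    ultimately show ?thesis by simp
  qed
qed

subsection \<open>Collapsible complexes and matroids\<close>

text \<open>
  The case \<open>s = {}\<close> is allowed: it creates the first vertex together with the empty face, so that
  collapsibility means collapsibility to the void complex and needs no distinguished vertex.
\<close>

inductive collapsible :: "'v set set \<Rightarrow> bool" where
  void: "collapsible {}"
| expand: "collapsible C \<Longrightarrow> finite s \<Longrightarrow> v \<notin> s \<Longrightarrow> s \<notin> C \<Longrightarrow> insert v s \<notin> C \<Longrightarrow>
    (\<And>r. r \<subseteq> insert v s \<Longrightarrow> r \<noteq> s \<Longrightarrow> r \<noteq> insert v s \<Longrightarrow> r \<in> C) \<Longrightarrow>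
    collapsible (insert s (insert (insert v s) C))"

lemma collapsible_finite: "collapsible C \<Longrightarrow> finite C"
  by (induction rule: collapsible.induct) auto

lemma collapsible_down_closed: "collapsible C \<Longrightarrow> s \<in> C \<Longrightarrow> r \<subseteq> s \<Longrightarrow> r \<in> C"
proof (induction arbitrary: s r rule: collapsible.induct)
  case (expand C s' v)
  from expand.prems(1) consider "s = s'" | "s = insert v s'" | "s \<in> C" by blast
  then show ?case
  proof cases
    case 1
    then show ?thesis using expand.prems(2) expand.hyps(6)[of r] by blast
  next
    case 2
    then show ?thesis using expand.prems(2) expand.hyps(6)[of r] by blast
  next
    case 3
    then show ?thesis using expand.IH expand.prems(2) by blast
  qed
qed auto

lemma collapsible_euler: "collapsible C \<Longrightarrow> (\<Sum>s\<in>C. (- 1) ^ card s) = (0::real)"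
proof (induction rule: collapsible.induct)
  case (expand C s v)
  moreover have "s \<noteq> insert v s" using expand by blast
  ultimately show ?case by (simp add: collapsible_finite)
qed auto

text \<open>Each face \<open>s\<close> of \<open>D\<close> is added together with its partner
  \<open>insert e s\<close>, which is an expansion with apex \<open>e\<close> once all proper
  subsets of \<open>s\<close> have been treated.\<close>

lemma collapsible_cone:
  assumes "finite D" "\<And>s. s \<in> D \<Longrightarrow> finite s" "\<And>s. s \<in> D \<Longrightarrow> e \<notin> s"
    and "\<And>r s. s \<in> D \<Longrightarrow> r \<subseteq> s \<Longrightarrow> r \<in> D"
  shows "collapsible (D \<union> insert e ` D)"
  using assms
proof (induction "card D" arbitrary: D)
  case 0
  then show ?case by (simp add: collapsible.void)
next
  case (Suc k)
  then have "D \<noteq> {}" by auto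
  \<comment> \<open>A face of largest cardinality is maximal, so \<open>D\<close> without it stays
    down-closed.\<close>
  then obtain s where s: "s \<in> D" "\<And>r. r \<in> D \<Longrightarrow> card r \<le> card s"
    using Suc.prems(1) obtains_MAX[of D card] by (metis Max_ge finite_imageI imageI)
  have max: "\<not> s \<subset> r" if "r \<in> D" for r
    using s(2)[OF that] psubset_card_mono[OF Suc.prems(2)[OF that], of s] by linarith
  define D' where "D' = D - {s}"
  have "k = card D'" using Suc.hyps(2) s(1) Suc.prems(1) by (simp add: D'_def)
  moreover have "finite D'" "\<And>t. t \<in> D' \<Longrightarrow> finite t" "\<And>t. t \<in> D' \<Longrightarrow> e \<notin> t"
    using Suc.prems(1-3) by (auto simp: D'_def)
  moreover have "r \<in> D'" if "t \<in> D'" "r \<subseteq> t" for r t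
    using that Suc.prems(4)[of t r] max[of t] unfolding D'_def by blast
  ultimately have D': "collapsible (D' \<union> insert e ` D')"
    by (rule Suc.hyps(1))
  have es: "e \<notin> s" using Suc.prems(3) s by blast
  have mem: "r \<in> D'" if "r \<subseteq> s" "r \<noteq> s" for r
    using Suc.prems(4)[OF s(1) that(1)] that(2) by (simp add: D'_def)
  have "collapsible (insert s (insert (insert e s) (D' \<union> insert e ` D')))"
  proof (rule collapsible.expand[OF D'])
    show "finite s" "e \<notin> s" using Suc.prems s by auto
    show "s \<notin> D' \<union> insert e ` D'" using es by (auto simp: D'_def)
    show "insert e s \<notin> D' \<union> insert e ` D'"
    proof
      assume "insert e s \<in> D' \<union> insert e ` D'"
      moreover have "insert e s \<notin> D'" using Suc.prems(3)[of "insert e s"] by (auto simp: D'_def)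
      ultimately obtain t where t: "t \<in> D'" "insert e s = insert e t" by blast
      moreover have "e \<notin> t" using Suc.prems(3)[of t] t(1) by (simp add: D'_def)
      ultimately have "s = t" using es by (simp add: insert_ident)
      then show False using t(1) by (simp add: D'_def)
    qed
    fix r assume r: "r \<subseteq> insert e s" "r \<noteq> s" "r \<noteq> insert e s"
    show "r \<in> D' \<union> insert e ` D'"
    proof (cases "e \<in> r")
      case True
      then have *: "insert e (r - {e}) = r" by (rule insert_Diff)
      have "r - {e} \<in> D'"
      proof (rule mem)
        show "r - {e} \<subseteq> s" using r(1) by blast
        show "r - {e} \<noteq> s" using r(3) * by metis
      qed
      then show ?thesis using * by (metis UnI2 imageI)
    next
      case False
      then have "r \<subseteq> s" using r by blast
      then show ?thesis using mem[of r] r(2) by blast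
    qed
  qed
  moreover have "insert s (insert (insert e s) (D' \<union> insert e ` D')) = D \<union> insert e ` D"
  proof -
    have "D = insert s D'" using s(1) by (simp add: D'_def insert_absorb)
    then show ?thesis by (simp add: insert_commute)
  qed
  ultimately show ?case by simp
qed

text \<open>An expansion of \<open>B\<close> by \<open>s\<close> and \<open>insert v s\<close> lifts
  to one by \<open>insert e s\<close> and \<open>insert v (insert e s)\<close>, because all faces
  without \<open>e\<close> already lie in \<open>A\<close>. The first lift, with
  \<open>s = {}\<close>, adds the vertex \<open>e\<close> together with the edge from
  \<open>e\<close> to \<open>v\<close>.\<close>

lemma collapsible_attach_cone:
  assumes A: "collapsible A" "\<And>s. s \<in> A \<Longrightarrow> e \<notin> s"
    and B: "collapsible B" "B \<subseteq> A"
  shows "collapsible (A \<union> insert e ` B)"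
  using B
proof (induction rule: collapsible.induct)
  case void
  then show ?case using A by simp
next
  case (expand B s v)
  have sA: "s \<in> A" "insert v s \<in> A" and BA: "B \<subseteq> A" using expand.prems by auto
  then have e: "e \<notin> insert v s" using A(2) by blast
  have notin: "insert e t \<notin> A \<union> insert e ` B" if "t \<notin> B" "t \<in> A" for t
  proof
    assume "insert e t \<in> A \<union> insert e ` B"
    then obtain u where "u \<in> B" "insert e t = insert e u" using A(2) by blast
    then show False using that A(2)[of u] A(2)[of t] BA by (metis insert_ident subsetD)
  qed
  have "collapsible (insert (insert e s) (insert (insert v (insert e s)) (A \<union> insert e ` B)))"
  proof (rule collapsible.expand)
    show "collapsible (A \<union> insert e ` B)" using expand BA by blast
    show "finite (insert e s)" "v \<notin> insert e s" using expand e by auto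
    show "insert e s \<notin> A \<union> insert e ` B" using notin expand sA by blast
    show "insert v (insert e s) \<notin> A \<union> insert e ` B"
      using notin[of "insert v s"] expand sA by (simp add: insert_commute)
    fix r assume r: "r \<subseteq> insert v (insert e s)" "r \<noteq> insert e s" "r \<noteq> insert v (insert e s)"
    show "r \<in> A \<union> insert e ` B"
    proof (cases "e \<in> r")
      case True
      then have *: "r - {e} \<subseteq> insert v s" "r - {e} \<noteq> s" "r - {e} \<noteq> insert v s"
        "r = insert e (r - {e})" using r by auto
      then show ?thesis using expand.hyps(6)[OF *(1-3)] by blast
    next
      case False
      then have "r \<subseteq> insert v s" using r by blast
      then show ?thesis using collapsible_down_closed[OF A(1) sA(2)] by blast
    qed
  qed
  moreover have "insert (insert e s) (insert (insert v (insert e s)) (A \<union> insert e ` B))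
      = A \<union> insert e ` insert s (insert (insert v s) B)"
    by (auto simp: insert_commute)
  ultimately show ?case by simp
qed

text \<open>Here \<open>r\<close> is the rank and \<open>I\<close> the family of independent sets.\<close>

definition matroid :: "'v set set \<Rightarrow> nat \<Rightarrow> bool" where
  "matroid I r \<longleftrightarrow> finite I \<and> (\<forall>s\<in>I. finite s \<and> card s \<le> r) \<and> (\<exists>s\<in>I. card s = r) \<and>
     (\<forall>s\<in>I. \<forall>t. t \<subseteq> s \<longrightarrow> t \<in> I) \<and>
     (\<forall>s\<in>I. \<forall>t\<in>I. card s < card t \<longrightarrow> (\<exists>x\<in>t - s. insert x s \<in> I))"

lemma matroid_extend_to_basis:
  assumes "matroid I r" "s \<in> I"
  obtains b where "b \<in> I" "card b = r" "s \<subseteq> b"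
proof -
  have "\<exists>b\<in>I. card b = r \<and> s \<subseteq> b"
    using assms(2)
  proof (induction "r - card s" arbitrary: s)
    case 0
    then show ?case using assms(1) unfolding matroid_def by (metis diff_is_0_eq order_antisym order_refl)
  next
    case (Suc k)
    then obtain t where t: "t \<in> I" "card s < card t"
      using assms(1) unfolding matroid_def by (metis zero_less_Suc zero_less_diff)
    then obtain x where x: "x \<in> t - s" "insert x s \<in> I"
      using assms(1) Suc.prems unfolding matroid_def by meson
    moreover have "finite s" using assms(1) Suc.prems unfolding matroid_def by blast
    ultimately have "k = r - card (insert x s)" using Suc.hyps(2) by simp
    then show ?case using Suc.hyps(1)[OF _ x(2)] by blast
  qed
  then show thesis using that by blast
qed

text \<open>Induction on the size of the family. The set \<open>H\<close> consists of the bases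
  removed from the deletion and of those removed from the contraction, the latter enlarged by
  \<open>e\<close>.\<close>

lemma matroid_collapsible:
  assumes "matroid I r"
  obtains H where "H \<subseteq> I" "\<And>s. s \<in> H \<Longrightarrow> card s = r" "collapsible (I - H)"
proof -
  have "\<exists>H\<subseteq>I. (\<forall>s\<in>H. card s = r) \<and> collapsible (I - H)"
    using assms
  proof (induction "card I" arbitrary: I r rule: less_induct)
    case less
    note M = less.prems
    have fI: "finite I" and fin: "\<And>s. s \<in> I \<Longrightarrow> finite s" and le: "\<And>s. s \<in> I \<Longrightarrow> card s \<le> r"
      and down: "\<And>s t. s \<in> I \<Longrightarrow> t \<subseteq> s \<Longrightarrow> t \<in> I"
      and aug: "\<And>s t. s \<in> I \<Longrightarrow> t \<in> I \<Longrightarrow> card s < card t \<Longrightarrow> \<exists>x\<in>t - s. insert x s \<in> I"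
      and ex: "\<exists>s\<in>I. card s = r"
      using M unfolding matroid_def by blast+
    have emp: "{} \<in> I" using ex down by blast
    show ?case
    proof (cases "I = {{}}")
      case True
      then have "r = 0" using ex by auto
      \<comment> \<open>In rank 0 the empty set is itself the only basis; removing it leaves the
        void family.\<close>
      then show ?thesis using True by (intro exI[of _ I]) (auto intro: collapsible.void)
    next
      case False
      then obtain s e where "s \<in> I" "e \<in> s" using emp by blast
      then have e: "{e} \<in> I" using down by blast
      \<comment> \<open>\<open>D\<close> is the deletion of \<open>e\<close> and \<open>L\<close>
        the contraction, that is, the link of \<open>e\<close>. Thus \<open>I\<close> is
        \<open>D\<close> with a cone over \<open>L\<close> attached.\<close>
      define D where "D = {s \<in> I. e \<notin> s}"
      define L where "L = {s \<in> I. e \<notin> s \<and> insert e s \<in> I}"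
      have I: "I = D \<union> insert e ` L"
      proof
        show "D \<union> insert e ` L \<subseteq> I" by (auto simp: D_def L_def)
        show "I \<subseteq> D \<union> insert e ` L"
        proof
          fix s assume s: "s \<in> I"
          show "s \<in> D \<union> insert e ` L"
          proof (cases "e \<in> s")
            case True
            then have "insert e (s - {e}) = s" by blast
            moreover have "s - {e} \<in> I" using down[OF s] by blast
            ultimately show ?thesis unfolding L_def using s by (metis (mono_tags, lifting) CollectI Diff_iff UnI2 imageI insertI1)
          qed (use s in \<open>auto simp: D_def\<close>)
        qed
      qed
      have LD: "L \<subseteq> D" and DI: "D \<subset> I" using e by (auto simp: D_def L_def)
      have fD: "finite D" using DI fI finite_subset by blast
      show ?thesis
      proof (cases "\<exists>s\<in>D. card s = r")
        case False
        \<comment> \<open>\<open>e\<close> is a coloop, so \<open>I\<close> is a cone with apex \<open>e\<close>.\<close>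
        have "D \<subseteq> L"
        proof
          fix s assume s: "s \<in> D"
          then obtain b where b: "b \<in> I" "card b = r" "s \<subseteq> b"
            using matroid_extend_to_basis[OF M] D_def by blast
          then have "e \<in> b" using False D_def by blast
          then show "s \<in> L" using s b down[of b "insert e s"] by (auto simp: D_def L_def)
        qed
        then have "I = D \<union> insert e ` D" using I LD by blast
        moreover have "collapsible (D \<union> insert e ` D)"
          by (rule collapsible_cone[OF fD]) (use fin down in \<open>auto simp: D_def\<close>)
        ultimately show ?thesis by (intro exI[of _ "{}"]) auto
      next
        case True
        \<comment> \<open>Some basis avoids \<open>e\<close> in this case, so the deletion keeps the
          rank \<open>r\<close>, while the contraction has rank \<open>r - 1\<close>.\<close>
        have DM: "matroid D r"
          unfolding matroid_def
        proof (intro conjI ballI impI allI)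
          fix s t assume "s \<in> D" "t \<in> D" "card s < card t"
          then show "\<exists>x\<in>t - s. insert x s \<in> D" using aug[of s t] by (auto simp: D_def)
        qed (use fD fin le True down in \<open>auto simp: D_def\<close>)
        obtain b where b: "b \<in> I" "card b = r" "{e} \<subseteq> b"
          using matroid_extend_to_basis[OF M e] .
        have bL: "b - {e} \<in> L" using b down[of b "b - {e}"] by (auto simp: L_def insert_absorb)
        have cb: "card (b - {e}) = r - 1" using b by simp
        have ci: "card (insert e s) = Suc (card s)" if "s \<in> L" for s
          using that fin by (simp add: L_def)
        have cL: "Suc (card s) \<le> r" if "s \<in> L" for s
          using ci[OF that] le[of "insert e s"] that by (simp add: L_def)
        have LM: "matroid L (r - 1)"
          unfolding matroid_def
        proof (intro conjI ballI impI allI)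
          show "finite L" using LD fD finite_subset by blast
          show "\<exists>s\<in>L. card s = r - 1" using bL cb by blast
          fix s t assume s: "s \<in> L" and t: "t \<in> L" "card s < card t"
          then obtain x where "x \<in> insert e t - insert e s" "insert x (insert e s) \<in> I"
            using aug[of "insert e s" "insert e t"] ci by (auto simp: L_def)
          then show "\<exists>x\<in>t - s. insert x s \<in> L"
            using s t down[of "insert x (insert e s)" "insert x s"]
            by (intro bexI[of _ x]) (auto simp: L_def insert_commute)
        next
          fix s assume s: "s \<in> L"
          show "finite s" using s fin by (auto simp: L_def)
          show "card s \<le> r - 1" using cL[OF s] by simp
          fix t assume "t \<subseteq> s"
          then show "t \<in> L" using s down[of s t] down[of "insert e s" "insert e t"] by (auto simp: L_def)
        qed
        have "card D < card I" "card L < card I"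
          using psubset_card_mono[OF fI DI] card_mono[OF fD LD] by auto
        then obtain H1 H2 where H1: "H1 \<subseteq> D" "\<And>s. s \<in> H1 \<Longrightarrow> card s = r" "collapsible (D - H1)"
          and H2: "H2 \<subseteq> L" "\<And>s. s \<in> H2 \<Longrightarrow> card s = r - 1" "collapsible (L - H2)"
          using less.hyps DM LM by metis
        \<comment> \<open>Sets in \<open>L\<close> have fewer than \<open>r\<close> elements and
          sets in \<open>H1\<close> exactly \<open>r\<close>. Hence \<open>L - H2\<close> lies
          inside \<open>D - H1\<close>, as the attachment of the cone demands.\<close>
        have "L \<inter> H1 = {}" using H1(2) cL by fastforce
        then have col: "collapsible ((D - H1) \<union> insert e ` (L - H2))"
          using collapsible_attach_cone[OF H1(3) _ H2(3)] LD by (auto simp: D_def)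
        have inj: "inj_on (insert e) L" by (rule inj_onI) (auto simp: L_def)
        have "insert e ` (L - H2) = insert e ` L - insert e ` H2"
          using inj_on_image_set_diff[OF inj, of L H2] H2(1) by simp
        moreover have "D \<inter> insert e ` H2 = {}" "insert e ` L \<inter> H1 = {}"
          using H1(1) by (auto simp: D_def)
        moreover have "(D \<union> M) - (H1 \<union> N) = (D - H1) \<union> (M - N)"
          if "D \<inter> N = {}" "M \<inter> H1 = {}" for M N
          using that by blast
        ultimately have "I - (H1 \<union> insert e ` H2) = (D - H1) \<union> insert e ` (L - H2)"
          using I by presburger
        then have "collapsible (I - (H1 \<union> insert e ` H2))" using col by simp
        moreover have "H1 \<union> insert e ` H2 \<subseteq> I" 
          using Un_mono[OF H1(1) image_mono[OF H2(1)]] I by blast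
        moreover have "card s = r" if "s \<in> H1 \<union> insert e ` H2" for s
          using that
        proof
          assume "s \<in> insert e ` H2"
          then obtain t where t: "t \<in> H2" "s = insert e t" by blast
          then have "t \<in> L" using H2(1) by blast
          then show ?thesis using ci[of t] cL[of t] H2(2)[OF t(1)] t(2) by simp
        qed (rule H1(2))
        ultimately show ?thesis by blast
      qed
    qed
  qed
  then show thesis using that by blast
qed

subsection \<open>Barycentric coordinates\<close>

lemma continuous_on_Min_image:
  fixes f :: "'i \<Rightarrow> 'a::topological_space \<Rightarrow> real"
  assumes "finite s" "s \<noteq> {}" "\<And>i. i \<in> s \<Longrightarrow> continuous_on S (f i)"
  shows "continuous_on S (\<lambda>a. Min ((\<lambda>i. f i a) ` s))"
  using assms
proof (induction rule: finite_ne_induct)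
  case (insert x F)
  then have "continuous_on S (\<lambda>a. min (f x a) (Min ((\<lambda>i. f i a) ` F)))"
    by (intro continuous_on_min) auto
  moreover have "Min ((\<lambda>i. f i a) ` insert x F) = min (f x a) (Min ((\<lambda>i. f i a) ` F))" for a
    using insert.hyps by simp
  ultimately show ?case by (simp only:)
qed simp

lemma continuous_on_coordinate:
  fixes f :: "'a::topological_space \<Rightarrow> 'v \<Rightarrow> real"
  shows "continuous_on S f \<Longrightarrow> continuous_on S (\<lambda>x. f x v)"
  by (rule continuous_on_product_then_coordinatewise)

text \<open>The underlying set of \<open>geometric_realization\<close>, kept separate so that
  \<open>continuous_on\<close>, \<open>compact\<close> and \<open>contractible\<close> apply to it
  in the function space.\<close>

definition barycentric :: "'v set set \<Rightarrow> ('v \<Rightarrow> real) set" where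
  "barycentric K = {a. (\<forall>v. 0 \<le> a v) \<and> {v. a v \<noteq> 0} \<in> K \<and> (\<Sum>v | a v \<noteq> 0. a v) = 1}"

lemma geometric_realization_barycentric: "geometric_realization K = top_of_set (barycentric K)"
  by (simp add: geometric_realization_def barycentric_def euclidean_product_topology)

lemma barycentric_iff:
  fixes K :: "'v::finite set set"
  shows "a \<in> barycentric K \<longleftrightarrow> (\<forall>v. 0 \<le> a v) \<and> {v. a v \<noteq> 0} \<in> K \<and> (\<Sum>v\<in>UNIV. a v) = 1"
proof -
  have "(\<Sum>v | a v \<noteq> 0. a v) = (\<Sum>v\<in>UNIV. a v)"
    by (rule sum.mono_neutral_left) auto
  then show ?thesis by (simp add: barycentric_def)
qed

lemma barycentric_vertex: "{v} \<in> K \<Longrightarrow> (\<lambda>w. if w = v then 1 else 0) \<in> barycentric K"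
  by (auto simp: barycentric_def)

text \<open>The realization is a finite union of closed simplices \<open>?C s\<close> inside a
  compact cube. Down-closure matters because a point of \<open>?C s\<close> may be supported on a
  proper face of \<open>s\<close>.\<close>

lemma compact_barycentric:
  fixes K :: "'v::finite set set"
  assumes down: "\<And>s t. s \<in> K \<Longrightarrow> t \<subseteq> s \<Longrightarrow> t \<in> K"
  shows "compact (barycentric K)"
proof -
  let ?B = "{a::'v \<Rightarrow> real. \<forall>v. a v \<in> {0..1}}"
  let ?C = "\<lambda>s. {a::'v \<Rightarrow> real. (\<forall>v. 0 \<le> a v) \<and> (\<forall>v\<in>- s. a v = 0) \<and> (\<Sum>v\<in>UNIV. a v) = 1}"
  have "compactin (powertop_real UNIV) (PiE UNIV (\<lambda>_::'v. {0..1::real}))"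
    by (subst compactin_PiE) auto
  then have B: "compact ?B" by (simp add: euclidean_product_topology PiE_def Pi_def)
  have c: "continuous_on UNIV (\<lambda>a::'v \<Rightarrow> real. a v)" for v by simp
  have "closed (?C s)" for s
    unfolding Ball_def
    by (intro closed_Collect_conj closed_Collect_all closed_Collect_imp closed_Collect_le
        closed_Collect_eq open_Collect_const continuous_intros c)
  then have "closed (\<Union>s\<in>K. ?C s)" by (intro closed_UN) auto
  moreover have "(\<Union>s\<in>K. ?C s) = barycentric K"
  proof (intro equalityI subsetI)
    fix a assume "a \<in> (\<Union>s\<in>K. ?C s)"
    then obtain s where s: "s \<in> K" "a \<in> ?C s" by blast
    then have "{v. a v \<noteq> 0} \<subseteq> s" by auto
    then show "a \<in> barycentric K" using s down[OF s(1)] by (simp add: barycentric_iff)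
  next
    fix a assume "a \<in> barycentric K"
    then show "a \<in> (\<Union>s\<in>K. ?C s)" by (auto simp: barycentric_iff intro!: bexI[of _ "{v. a v \<noteq> 0}"])
  qed
  moreover have "barycentric K \<subseteq> ?B"
  proof
    fix a assume a: "a \<in> barycentric K"
    have "a v \<le> (\<Sum>v\<in>UNIV. a v)" for v
      by (rule member_le_sum) (use a in \<open>auto simp: barycentric_iff\<close>)
    then show "a \<in> ?B" using a by (auto simp: barycentric_iff)
  qed
  ultimately have "closed (barycentric K)" "?B \<inter> barycentric K = barycentric K" by auto
  then show ?thesis using compact_Int_closed[OF B, of "barycentric K"] by simp
qed

text \<open>The family \<open>{{}}\<close> would have an empty realization. Collapsibility excludes
  it, since the first expansion adds the empty face together with a vertex.\<close>

lemma collapsible_has_vertex: "collapsible C \<Longrightarrow> C \<noteq> {} \<Longrightarrow> \<exists>v. {v} \<in> C"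
proof (induction rule: collapsible.induct)
  case (expand C s v)
  show ?case
  proof (cases "C = {}")
    case True
    then have "s = {}" using expand.hyps(3) expand.hyps(6)[of "{}"] by blast
    then show ?thesis by auto
  qed (use expand.IH in blast)
qed simp

text \<open>After an expansion the new realization deformation retracts onto the old one, which
  transports contractibility. The first expansion is separate: nothing is there to retract onto, and
  the realization is a single point.\<close>

lemma contractible_barycentric_collapsible:
  fixes C :: "'v::finite set set"
  assumes "collapsible C"
  shows "contractible (barycentric C)"
  using assms
proof (induction rule: collapsible.induct)
  case void
  have "barycentric {} = ({} :: ('v \<Rightarrow> real) set)" by (simp add: barycentric_def)
  then show ?case by simp
next
  case (expand C s v)
  let ?D = "insert s (insert (insert v s) C)"
  show ?case
  proof (cases "s = {}")
    case True
    let ?\<delta> = "\<lambda>w. if w = v then 1 else (0::real)"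
    have "C = {}" using collapsible_down_closed[OF expand.hyps(1), of _ "{}"] expand.hyps(4) True by blast
    have "barycentric ?D = {?\<delta>}"
    proof (intro equalityI subsetI)
      fix a assume a: "a \<in> barycentric ?D"
      then have "{w. a w \<noteq> 0} = {} \<or> {w. a w \<noteq> 0} = {v}"
        using True \<open>C = {}\<close> by (simp add: barycentric_def)
      moreover have "(\<Sum>w | a w \<noteq> 0. a w) = 1" using a by (simp add: barycentric_def)
      ultimately have "{w. a w \<noteq> 0} = {v}" "a v = 1" by auto
      then show "a \<in> {?\<delta>}" by (auto simp: fun_eq_iff)
    qed (use barycentric_vertex[of v ?D] True in auto)
    then show ?thesis
      unfolding contractible_space_top_of_set[symmetric]
      by (simp add: contractible_space_singleton)
  next
    case False
    have Dsub: "t \<in> ?D" if "t \<subseteq> insert v s" for t using expand.hyps(6)[OF that] by blast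
    \<comment> \<open>\<open>m\<close> measures the distance from the old realization: it vanishes
      on \<open>barycentric C\<close>, since no face in \<open>C\<close> contains \<open>s\<close>,
      and where it is positive the support is \<open>s\<close> or \<open>insert v s\<close>.\<close>
    define m where "m a = Min (a ` s)" for a :: "'v \<Rightarrow> real"
    \<comment> \<open>\<open>r (t, a)\<close> moves \<open>a\<close> away from the vertices in \<open>s\<close> towards \<open>v\<close>; at \<open>t = 1\<close> some coordinate
      in \<open>s\<close> has become zero.\<close>
    define r where "r = (\<lambda>(t, a::'v \<Rightarrow> real) w. a w - t * m a * (if w \<in> s then 1 else 0)
        + t * m a * card s * (if w = v then 1 else 0))"
    have mle: "m a \<le> a w" if "w \<in> s" for a w unfolding m_def using that by simp
    have mex: "\<exists>w\<in>s. a w = m a" for a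
      unfolding m_def using False Min_in[of "a ` s"] by fastforce
    have m0: "0 \<le> m a" if "a \<in> barycentric ?D" for a
      using mex[of a] that unfolding barycentric_iff by metis
    have supp: "{w. a w \<noteq> 0} \<subseteq> insert v s \<and> {w. a w \<noteq> 0} \<notin> C"
      if "a \<in> barycentric ?D" "0 < m a" for a
    proof -
      have "s \<subseteq> {w. a w \<noteq> 0}" using mle[of _ a] that(2) by fastforce
      then have "{w. a w \<noteq> 0} \<notin> C"
        using collapsible_down_closed[OF expand.hyps(1)] expand.hyps(4) by blast
      then show ?thesis using that(1) by (auto simp: barycentric_iff)
    qed
    \<comment> \<open>Each of the \<open>card s\<close> vertices loses \<open>t * m a\<close>, and
      \<open>v\<close> gains exactly the total.\<close>
    have sum_r: "(\<Sum>w\<in>UNIV. r (t, a) w) = (\<Sum>w\<in>UNIV. a w)" for t a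
    proof -
      have "(\<Sum>w\<in>UNIV. r (t, a) w) = (\<Sum>w\<in>UNIV. a w) - (\<Sum>w\<in>UNIV. t * m a * (if w \<in> s then 1 else 0))
        + (\<Sum>w\<in>UNIV. t * m a * card s * (if w = v then 1 else 0))"
        unfolding r_def by (simp add: sum.distrib sum_subtractf)
      also have "(\<Sum>w\<in>UNIV. t * m a * (if w \<in> s then 1 else 0)) = t * m a * card s"
        unfolding sum_distrib_left[symmetric] by (simp add: sum.If_cases)
      also have "(\<Sum>w\<in>UNIV. t * m a * card s * (if w = v then 1 else 0)) = t * m a * card s"
        unfolding sum_distrib_left[symmetric] by simp
      finally show ?thesis by simp
    qed
    have pos: "0 \<le> r (t, a) w" if "t \<in> {0..1}" "a \<in> barycentric ?D" for t a w
    proof -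
      have "t * m a \<le> m a" using m0[OF that(2)] that(1) by (simp add: mult_left_le_one_le)
      moreover have "0 \<le> t * m a * card s" using m0[OF that(2)] that(1) by simp
      moreover have "0 \<le> a w" using that(2) by (simp add: barycentric_iff)
      ultimately show ?thesis using mle[of w a] by (auto simp: r_def)
    qed
    have sub: "{w. r (t, a) w \<noteq> 0} \<subseteq> insert v s" if "a \<in> barycentric ?D" "0 < m a" for t a
      using supp[OF that] by (auto simp: r_def)
    have r_id: "r (t, a) = a" if "m a = 0" for t a by (simp add: r_def that fun_eq_iff)
    have rD: "r (t, a) \<in> barycentric ?D" if "t \<in> {0..1}" "a \<in> barycentric ?D" for t a
    proof (cases "m a = 0")
      case True
      then show ?thesis using that r_id by simp
    next
      case False
      then have "{w. r (t, a) w \<noteq> 0} \<in> ?D" using Dsub sub[OF that(2)] m0[OF that(2)] by simp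
      then show ?thesis using pos[OF that] sum_r[of t a] that(2) unfolding barycentric_iff by simp
    qed
    have rC: "r (1, a) \<in> barycentric C" if a: "a \<in> barycentric ?D" for a
    proof -
      have "{w. r (1, a) w \<noteq> 0} \<in> C"
      proof (cases "m a = 0")
        case True
        obtain w where w: "w \<in> s" "a w = 0" using mex[of a] True by auto
        then have "{w. a w \<noteq> 0} \<noteq> s" "{w. a w \<noteq> 0} \<noteq> insert v s" by auto
        then show ?thesis using a r_id[OF True] by (simp add: barycentric_iff)
      next
        case False
        then have "0 < m a" using m0[OF a] by simp
        moreover obtain w where w: "w \<in> s" "a w = m a" using mex[of a] by auto
        then have "r (1, a) w = 0" using expand.hyps(3) by (auto simp: r_def)
        then have "{w. r (1, a) w \<noteq> 0} \<noteq> s" "{w. r (1, a) w \<noteq> 0} \<noteq> insert v s" using w(1) by auto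
        ultimately show ?thesis using expand.hyps(6)[OF sub[OF a]] by blast
      qed
      then show ?thesis using pos[OF _ a, of 1] sum_r[of 1 a] a unfolding barycentric_iff by simp
    qed
    have mC: "m a = 0" if "a \<in> barycentric C" for a
    proof (rule ccontr)
      assume "m a \<noteq> 0"
      moreover have "a \<in> barycentric ?D" using that by (auto simp: barycentric_iff)
      ultimately show False using supp[of a] m0[of a] that by (auto simp: barycentric_iff)
    qed
    have CD: "barycentric C \<subseteq> barycentric ?D" by (auto simp: barycentric_iff)
    have cont: "continuous_on ({0..1} \<times> barycentric ?D) r"
    proof (rule continuous_on_coordinatewise_then_product)
      fix w
      let ?S = "{0..1::real} \<times> barycentric ?D"
      have c: "continuous_on ?S (\<lambda>z. snd z w)" for w
        by (rule continuous_on_coordinate[OF continuous_on_snd[OF continuous_on_id]])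
      have "continuous_on ?S (\<lambda>z. m (snd z))"
        unfolding m_def
        by (rule continuous_on_Min_image[where f = "\<lambda>w z. snd z w"]) (use False c in simp_all)
      then show "continuous_on ?S (\<lambda>z. r z w)"
        unfolding r_def case_prod_beta
        by (intro continuous_on_add continuous_on_diff continuous_on_mult continuous_on_const c
            continuous_on_fst continuous_on_id)
    qed
    have "homotopic_with (\<lambda>x. True) (top_of_set (barycentric ?D)) (top_of_set (barycentric ?D))
        id (\<lambda>a. r (1, a))"
      unfolding homotopic_with[where P = "\<lambda>x. True", OF refl]
      using cont rD by (intro exI[of _ r]) (auto simp: r_def)
    moreover have "retraction_maps (top_of_set (barycentric ?D)) (top_of_set (barycentric C))
        (\<lambda>a. r (1, a)) id"
      unfolding retraction_maps_def
    proof (intro conjI ballI)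
      have "continuous_on (barycentric ?D) (\<lambda>a. r (1, a))"
        by (rule continuous_on_compose2[OF cont]) (auto intro!: continuous_intros)
      then show "continuous_map (top_of_set (barycentric ?D)) (top_of_set (barycentric C)) (\<lambda>a. r (1, a))"
        using rC by auto
    qed (use CD mC r_id in auto)
    ultimately have "top_of_set (barycentric ?D) homotopy_equivalent_space top_of_set (barycentric C)"
      by (intro deformation_retract_imp_homotopy_equivalent_space)
         (auto simp: homotopic_with_sym[of _ _ _ id])
    then show ?thesis
      using homotopy_equivalent_space_contractibility expand.IH contractible_space_top_of_set by blast
  qed
qed

subsection \<open>A simplex modulo its boundary\<close>

text \<open>
  With \<open>m\<close> the least barycentric coordinate, \<open>b \<mapsto> ((b i - b 0) / m)\<close> is a homeomorphism from the open
  \<open>d\<close>-simplex onto \<open>d\<close>-space, and \<open>simplex_to_sphere\<close> is its composition with the inverse stereographic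
  projection from the base point, to which the boundary \<open>m = 0\<close> is sent. The last summand of the
  denominator vanishes on the simplex; it keeps the denominator positive at points of the
  realization outside the simplex.
\<close>

definition simplex_denominator :: "nat \<Rightarrow> (nat \<Rightarrow> real) \<Rightarrow> real" where
  "simplex_denominator d b =
     (\<Sum>i=1..d. (b i - b 0)\<^sup>2) + (Min (b ` {..d}))\<^sup>2 + (1 - (\<Sum>i\<le>d. b i))\<^sup>2"

definition simplex_to_sphere :: "nat \<Rightarrow> (nat \<Rightarrow> real) \<Rightarrow> nat \<Rightarrow> real" where
  "simplex_to_sphere d b = (\<lambda>i.
     if i = 0 then 1 - 2 * (Min (b ` {..d}))\<^sup>2 / simplex_denominator d b
     else if i \<le> d then 2 * Min (b ` {..d}) * (b i - b 0) / simplex_denominator d b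
     else 0)"

lemma Min_atMost_attained:
  fixes b :: "nat \<Rightarrow> real"
  obtains j where "j \<le> d" "b j = Min (b ` {..d})"
proof -
  have "Min (b ` {..d}) \<in> b ` {..d}" by (rule Min_in) auto
  then obtain j where "Min (b ` {..d}) = b j" "j \<in> {..d}" by (rule imageE)
  then show thesis using that[of j] by simp
qed

text \<open>If all squares vanish, the coordinates are equal, their common value is the minimum 0,
  and their sum would have to be both 0 and 1.\<close>

lemma simplex_denominator_pos:
  assumes "\<And>i. i \<le> d \<Longrightarrow> 0 \<le> b i"
  shows "0 < simplex_denominator d b"
proof (rule ccontr)
  let ?N = "\<Sum>i=1..d. (b i - b 0)\<^sup>2" and ?m = "Min (b ` {..d})" and ?S = "\<Sum>i\<le>d. b i"
  assume "\<not> 0 < simplex_denominator d b"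
  then have "?N + ?m\<^sup>2 + (1 - ?S)\<^sup>2 \<le> 0" by (simp add: simplex_denominator_def)
  moreover have N: "0 \<le> ?N" by (rule sum_nonneg) simp
  moreover have "0 \<le> ?m\<^sup>2" "0 \<le> (1 - ?S)\<^sup>2" by simp_all
  ultimately have z: "?N = 0" "?m\<^sup>2 = 0" "(1 - ?S)\<^sup>2 = 0" by linarith+
  have eq: "b i = b 0" if "i \<le> d" for i
  proof (cases "i = 0")
    case False
    then show ?thesis using z(1) that by (subst (asm) sum_nonneg_eq_0_iff) auto
  qed simp
  obtain j where j: "j \<le> d" "b j = ?m" by (rule Min_atMost_attained)
  then have "b 0 = 0" using eq[OF j(1)] z(2) by simp
  then have "b i = 0" if "i \<le> d" for i using eq[OF that] by simp
  then have "?S = 0" by simp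
  then show False using z(3) by simp
qed

lemma topspace_nsphere: "topspace (nsphere d) = {x. (\<Sum>i\<le>d. (x i)\<^sup>2) = 1 \<and> (\<forall>i>d. x i = 0)}"
  by (simp add: nsphere)

lemma sum_atMost_split_0: "(\<Sum>i\<le>d. f i) = f 0 + (\<Sum>i=1..d. f i)" for f :: "nat \<Rightarrow> real"
  by (simp add: atMost_atLeast0 sum.atLeast_Suc_atMost)

lemma simplex_to_sphere_base:
  assumes "Min (b ` {..d}) = 0"
  shows "simplex_to_sphere d b = (\<lambda>i. if i = 0 then 1 else 0)"
  using assms by (auto simp: simplex_to_sphere_def)

lemma simplex_to_sphere_not_base:
  assumes "\<And>i. i \<le> d \<Longrightarrow> 0 \<le> b i" "Min (b ` {..d}) \<noteq> 0"
  shows "simplex_to_sphere d b \<noteq> (\<lambda>i. if i = 0 then 1 else 0)"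
proof
  assume "simplex_to_sphere d b = (\<lambda>i. if i = 0 then 1 else 0)"
  then have "simplex_to_sphere d b 0 = 1" by simp
  then show False
    using assms simplex_denominator_pos[of d b] by (simp add: simplex_to_sphere_def)
qed

text \<open>The alternative in the second assumption is what a point of the realization offers:
  either some coordinate on the facet is zero, or the facet carries the whole mass. In the latter
  case the denominator is \<open>?N + ?m\<^sup>2\<close>, and the usual identity of stereographic
  projection applies.\<close>

lemma simplex_to_sphere_in_nsphere:
  assumes "\<And>i. i \<le> d \<Longrightarrow> 0 \<le> b i" "Min (b ` {..d}) = 0 \<or> (\<Sum>i\<le>d. b i) = 1"
  shows "simplex_to_sphere d b \<in> topspace (nsphere d)"
proof (cases "Min (b ` {..d}) = 0")
  case True
  then show ?thesis using in_topspace_nsphere by (simp add: simplex_to_sphere_base)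
next
  case False
  let ?N = "\<Sum>i=1..d. (b i - b 0)\<^sup>2" and ?m = "Min (b ` {..d})" and ?D = "simplex_denominator d b"
  have D: "?D = ?N + ?m\<^sup>2" using assms(2) False by (simp add: simplex_denominator_def)
  have D0: "?D \<noteq> 0" using simplex_denominator_pos[of d b] assms(1) by simp
  have "(\<Sum>i=1..d. (simplex_to_sphere d b i)\<^sup>2) = (\<Sum>i=1..d. (4 * ?m\<^sup>2 / ?D\<^sup>2) * (b i - b 0)\<^sup>2)"
    by (rule sum.cong) (auto simp: simplex_to_sphere_def power_mult_distrib power_divide)
  also have "\<dots> = (4 * ?m\<^sup>2 / ?D\<^sup>2) * (?D - ?m\<^sup>2)"
    unfolding sum_distrib_left[symmetric] using D by simp
  finally have "(\<Sum>i\<le>d. (simplex_to_sphere d b i)\<^sup>2)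
      = (1 - 2 * ?m\<^sup>2 / ?D)\<^sup>2 + (4 * ?m\<^sup>2 / ?D\<^sup>2) * (?D - ?m\<^sup>2)"
    unfolding sum_atMost_split_0 by (simp add: simplex_to_sphere_def)
  also have "\<dots> = 1" using D0 by (simp add: field_simps power2_eq_square)
  finally show ?thesis by (simp add: topspace_nsphere simplex_to_sphere_def)
qed

text \<open>Coordinate 0 determines \<open>m\<^sup>2 / D\<close>, after which the others determine
  the differences \<open>b i - b 0\<close> relative to \<open>m\<close>. So \<open>b\<close> and
  \<open>b'\<close> agree up to a scaling and a translation; the minima exclude the translation and
  the sums the scaling.\<close>

lemma simplex_to_sphere_inj:
  assumes b: "\<And>i. i \<le> d \<Longrightarrow> 0 \<le> b i" "(\<Sum>i\<le>d. b i) = 1" "Min (b ` {..d}) \<noteq> 0"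
    and b': "\<And>i. i \<le> d \<Longrightarrow> 0 \<le> b' i" "(\<Sum>i\<le>d. b' i) = 1" "Min (b' ` {..d}) \<noteq> 0"
    and eq: "simplex_to_sphere d b = simplex_to_sphere d b'"
    and i: "i \<le> d"
  shows "b i = b' i"
proof -
  define m m' D D' where "m = Min (b ` {..d})" and "m' = Min (b' ` {..d})"
    and "D = simplex_denominator d b" and "D' = simplex_denominator d b'"
  have D: "0 < D" "0 < D'" unfolding D_def D'_def using simplex_denominator_pos b(1) b'(1) by auto
  obtain j where j: "j \<le> d" "b j = m" unfolding m_def by (rule Min_atMost_attained)
  obtain j' where j': "j' \<le> d" "b' j' = m'" unfolding m'_def by (rule Min_atMost_attained)
  have m: "0 < m" "0 < m'"
    using b(1)[OF j(1)] b(3)[folded m_def] j(2) b'(1)[OF j'(1)] b'(3)[folded m'_def] j'(2)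
    by linarith+
  have le: "m \<le> b i" "m' \<le> b' i" if "i \<le> d" for i unfolding m_def m'_def using that by simp_all
  have c: "m\<^sup>2 / D = m'\<^sup>2 / D'"
    using fun_cong[OF eq, of 0] by (simp add: simplex_to_sphere_def m_def m'_def D_def D'_def)
  have diff: "b i - b 0 = m / m' * (b' i - b' 0)" if i: "i \<le> d" for i
  proof (cases "i = 0")
    case False
    then have "m * (b i - b 0) / D = m' * (b' i - b' 0) / D'"
      using fun_cong[OF eq, of i] i by (simp add: simplex_to_sphere_def m_def m'_def D_def D'_def)
    then have "m\<^sup>2 / D * ((b i - b 0) / m) = m'\<^sup>2 / D' * ((b' i - b' 0) / m')"
      using m by (simp add: power2_eq_square)
    moreover have "m'\<^sup>2 / D' \<noteq> 0" using m(2) D(2) by simp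
    ultimately have "(b i - b 0) / m = (b' i - b' 0) / m'"
      unfolding c by (metis mult_left_cancel)
    then show ?thesis using m by (simp add: field_simps)
  qed simp
  define \<rho> where "\<rho> = m / m'"
  have \<rho>: "0 < \<rho>" "\<rho> * m' = m" using m by (simp_all add: \<rho>_def)
  have diff': "b i = \<rho> * b' i + (b 0 - \<rho> * b' 0)" if "i \<le> d" for i
    using diff[OF that] by (simp add: \<rho>_def algebra_simps)
  \<comment> \<open>Evaluating at an index where \<open>b\<close> is minimal bounds the translation
    above by 0; an index where \<open>b'\<close> is minimal bounds it below by 0.\<close>
  have "\<rho> * m' \<le> \<rho> * b' j" using le(2)[OF j(1)] \<rho>(1) by simp
  then have "b 0 - \<rho> * b' 0 \<le> 0" using diff'[OF j(1)] j(2) \<rho>(2) by linarith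
  moreover have "0 \<le> b 0 - \<rho> * b' 0" using diff'[OF j'(1)] j'(2) \<rho>(2) le(1)[OF j'(1)] by simp
  ultimately have scale: "b i = \<rho> * b' i" if "i \<le> d" for i using diff'[OF that] by simp
  have "(\<Sum>i\<le>d. b i) = \<rho> * (\<Sum>i\<le>d. b' i)"
    unfolding sum_distrib_left by (rule sum.cong) (auto simp: scale)
  then show ?thesis using b(2) b'(2) scale[OF i] by simp
qed

lemma simplex_to_sphere_surj:
  assumes x: "x \<in> topspace (nsphere d)" "x \<noteq> (\<lambda>i. if i = 0 then 1 else 0)"
  obtains b where "\<And>i. i \<le> d \<Longrightarrow> 0 < b i" "(\<Sum>i\<le>d. b i) = 1" "simplex_to_sphere d b = x"
proof -
  let ?X = "\<Sum>i=1..d. (x i)\<^sup>2"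
  have sum: "(x 0)\<^sup>2 + ?X = 1" and above: "\<And>i. d < i \<Longrightarrow> x i = 0"
    using x(1) by (simp_all add: topspace_nsphere sum_atMost_split_0)
  have "0 \<le> ?X" by (rule sum_nonneg) simp
  have "x 0 \<noteq> 1"
  proof
    assume x0: "x 0 = 1"
    have "x i = 0" if "i \<noteq> 0" for i
    proof (cases "i \<le> d")
      case True
      have "?X = 0" using sum x0 by simp
      then show ?thesis using True that by (subst (asm) sum_nonneg_eq_0_iff) auto
    qed (use above in auto)
    then show False using x(2) x0 by auto
  qed
  moreover have "x 0 \<le> 1"
    using sum \<open>0 \<le> ?X\<close> by (smt (verit) power2_eq_square power_mono one_power2 mult_le_cancel_left1)
  ultimately have x0: "0 < 1 - x 0" by simp
  \<comment> \<open>\<open>y\<close> is the stereographic projection of \<open>x\<close>, with an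
    extra entry 0 at index 0. Shifting it so that the least entry becomes 1 and dividing by the sum
    \<open>S\<close> gives a point of the open simplex with minimum \<open>1 / S\<close>, so that
    \<open>(b i - b 0)\<close> divided by the minimum is \<open>y i\<close> again.\<close>
  define y where "y i = (if i = 0 then 0 else x i / (1 - x 0))" for i
  define k where "k = Min (y ` {..d})"
  define S where "S = (\<Sum>i\<le>d. 1 + y i - k)"
  define b where "b i = (1 + y i - k) / S" for i
  have kle: "k \<le> y i" if "i \<le> d" for i unfolding k_def using that by simp
  obtain j where j: "j \<le> d" "y j = k" unfolding k_def by (rule Min_atMost_attained)
  have S: "0 < S" unfolding S_def
    by (rule sum_pos) (use kle in \<open>force+\<close>)
  have pos: "0 < b i" if "i \<le> d" for i using kle[OF that] S by (simp add: b_def)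
  have sum_b: "(\<Sum>i\<le>d. b i) = 1" unfolding b_def sum_divide_distrib[symmetric] using S by (simp add: S_def)
  have m: "Min (b ` {..d}) = 1 / S"
  proof (rule Min_eqI)
    fix z assume "z \<in> b ` {..d}"
    then obtain i where "i \<le> d" "z = b i" by auto
    then show "1 / S \<le> z" using kle[of i] S by (simp add: b_def divide_right_mono)
  next
    show "1 / S \<in> b ` {..d}" using j by (auto simp: b_def intro!: image_eqI[of _ _ j])
  qed simp
  have diff: "b i - b 0 = y i / S" for i by (simp add: b_def y_def diff_divide_distrib add_divide_distrib)
  have "(\<Sum>i=1..d. (y i)\<^sup>2) = (\<Sum>i=1..d. (x i)\<^sup>2 / (1 - x 0)\<^sup>2)"
    by (rule sum.cong) (auto simp: y_def power_divide)
  also have "\<dots> = (1 - (x 0)\<^sup>2) / (1 - x 0)\<^sup>2"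
    unfolding sum_divide_distrib[symmetric] using sum by (simp add: algebra_simps)
  also have "1 - (x 0)\<^sup>2 = (1 - x 0) * (1 + x 0)" by (simp add: algebra_simps power2_eq_square)
  also have "\<dots> / (1 - x 0)\<^sup>2 = (1 + x 0) / (1 - x 0)" using x0 by (simp add: power2_eq_square)
  also have "\<dots> = 2 / (1 - x 0) - 1" using x0 by (simp add: field_simps)
  finally have Y: "(\<Sum>i=1..d. (y i)\<^sup>2) = 2 / (1 - x 0) - 1" .
  have "(\<Sum>i=1..d. (b i - b 0)\<^sup>2) = (\<Sum>i=1..d. (y i)\<^sup>2) / S\<^sup>2"
    unfolding diff power_divide sum_divide_distrib ..
  then have D: "simplex_denominator d b = 2 / (1 - x 0) / S\<^sup>2"
    unfolding simplex_denominator_def sum_b m Y by (simp add: power_divide diff_divide_distrib)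
  have "simplex_to_sphere d b i = x i" for i
    using x0 S above[of i] unfolding simplex_to_sphere_def D m diff
    by (auto simp: y_def field_simps power2_eq_square)
  then show thesis using that[of b] pos sum_b by blast
qed

lemma continuous_on_simplex_to_sphere:
  fixes f :: "'a::topological_space \<Rightarrow> nat \<Rightarrow> real"
  assumes "\<And>i. i \<le> d \<Longrightarrow> continuous_on S (\<lambda>a. f a i)" "\<And>a i. a \<in> S \<Longrightarrow> i \<le> d \<Longrightarrow> 0 \<le> f a i"
  shows "continuous_on S (\<lambda>a. simplex_to_sphere d (f a))"
proof (rule continuous_on_coordinatewise_then_product)
  fix i
  have m: "continuous_on S (\<lambda>a. Min (f a ` {..d}))"
    by (rule continuous_on_Min_image[where f = "\<lambda>i a. f a i"]) (use assms in auto)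
  have D: "continuous_on S (\<lambda>a. simplex_denominator d (f a))"
    unfolding simplex_denominator_def by (intro continuous_intros m assms(1)) auto
  have "simplex_denominator d (f a) \<noteq> 0" if "a \<in> S" for a
    using simplex_denominator_pos[of d "f a"] assms(2)[OF that] by simp
  then show "continuous_on S (\<lambda>a. simplex_to_sphere d (f a) i)"
    unfolding simplex_to_sphere_def
    by (cases "i = 0"; cases "i \<le> d") (auto intro!: continuous_intros m D assms(1))
qed

subsection \<open>Removing facets\<close>

lemma sum_single:
  fixes g :: "'a \<Rightarrow> real"
  assumes "finite H" "s \<in> H" "\<And>r. r \<in> H \<Longrightarrow> r \<noteq> s \<Longrightarrow> g r = 0"
  shows "sum g H = g s"
proof -
  have "sum g H = sum g {s}" by (rule sum.mono_neutral_right) (use assms in auto)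
  then show ?thesis by simp
qed

text \<open>The members of \<open>H\<close> have the largest cardinality that occurs, so they are
  facets: removing them leaves a subcomplex, and their interiors are pairwise disjoint.\<close>

locale facet_removal =
  fixes K H :: "'v::finite set set" and d :: nat
  assumes down: "\<And>s t. s \<in> K \<Longrightarrow> t \<subseteq> s \<Longrightarrow> t \<in> K"
    and HK: "H \<subseteq> K"
    and card_H: "\<And>s. s \<in> H \<Longrightarrow> card s = Suc d"
    and card_K: "\<And>s. s \<in> K \<Longrightarrow> card s \<le> Suc d"
begin

lemma facet_nonempty: "s \<in> H \<Longrightarrow> s \<noteq> {}"
  using card_H by fastforce

lemma Min_image_le: "w \<in> s \<Longrightarrow> Min (a ` s) \<le> a w" for a :: "'v \<Rightarrow> real"
  by simp

lemma Min_attained: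
  fixes a :: "'v \<Rightarrow> real"
  assumes "s \<in> H"
  obtains w where "w \<in> s" "a w = Min (a ` s)"
proof -
  have "Min (a ` s) \<in> a ` s" using facet_nonempty[OF assms] by (intro Min_in) auto
  then obtain w where "Min (a ` s) = a w" "w \<in> s" by (rule imageE)
  then show thesis using that[of w] by simp
qed

lemma Min_nonneg: "a \<in> barycentric K \<Longrightarrow> s \<in> H \<Longrightarrow> 0 \<le> Min (a ` s)"
  using Min_attained[of s a] unfolding barycentric_iff by metis

lemma support_facet:
  assumes a: "a \<in> barycentric K" and s: "s \<in> H" and m: "Min (a ` s) \<noteq> 0"
  shows "{v. a v \<noteq> 0} = s"
proof (rule sym, rule card_seteq)
  have "0 < Min (a ` s)" using Min_nonneg[OF a s] m by simp
  then show "s \<subseteq> {v. a v \<noteq> 0}" using Min_image_le[of _ s a] by fastforce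
  show "card {v. a v \<noteq> 0} \<le> card s" using a card_K card_H[OF s] by (simp add: barycentric_iff)
qed simp

lemma barycentric_core_iff:
  assumes a: "a \<in> barycentric K"
  shows "a \<in> barycentric (K - H) \<longleftrightarrow> (\<forall>s\<in>H. Min (a ` s) = 0)"
proof
  assume "a \<in> barycentric (K - H)"
  then show "\<forall>s\<in>H. Min (a ` s) = 0" using support_facet[OF a] by (auto simp: barycentric_iff)
next
  assume *: "\<forall>s\<in>H. Min (a ` s) = 0"
  have "{v. a v \<noteq> 0} \<notin> H"
  proof
    assume s: "{v. a v \<noteq> 0} \<in> H"
    obtain w where "w \<in> {v. a v \<noteq> 0}" "a w = Min (a ` {v. a v \<noteq> 0})"
      using Min_attained[OF s] .
    then show False using * s by simp
  qed
  then show "a \<in> barycentric (K - H)" using a by (simp add: barycentric_iff)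
qed

lemma barycentric_core_subset: "barycentric (K - H) \<subseteq> barycentric K"
  by (auto simp: barycentric_iff)

text \<open>Homotopy extension for the contraction of the subcomplex: the contraction is spread over
  the part of each removed facet near its boundary, and points deeper inside are only
  stretched.\<close>

lemma homotopy_extension:
  assumes "contractible (barycentric (K - H))"
  shows "\<exists>h x0.
    continuous_map (prod_topology (top_of_set {0..1::real}) (top_of_set (barycentric K)))
      (top_of_set (barycentric K)) h \<and>
    (\<forall>a\<in>barycentric K. h (0, a) = a) \<and>
    (\<forall>t\<in>{0..1}. \<forall>a\<in>barycentric (K - H). h (t, a) \<in> barycentric (K - H)) \<and>
    (\<forall>a\<in>barycentric (K - H). h (1, a) = x0)"
proof -
  let ?A = "barycentric (K - H)" and ?X = "barycentric K"
  obtain x0 where "homotopic_with_canon (\<lambda>x. True) ?A ?A id (\<lambda>x. x0)"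
    using assms by (auto simp: contractible_def)
  then obtain c :: "real \<times> ('v \<Rightarrow> real) \<Rightarrow> 'v \<Rightarrow> real" where
      c: "continuous_on ({0..1} \<times> ?A) c" "c ` ({0..1} \<times> ?A) \<subseteq> ?A"
      "\<forall>a\<in>?A. c (0, a) = a" "\<forall>a\<in>?A. c (1, a) = x0"
    unfolding homotopic_with[where P = "\<lambda>x. True", OF refl] by (auto simp: image_subset_iff_funcset)
  \<comment> \<open>\<open>N\<close> is the number of vertices of a removed facet, so
    \<open>N * \<mu> s t a\<close> is the mass that \<open>\<phi>\<close> subtracts before
    rescaling. The cap \<open>t / (2 * N)\<close> keeps this mass at most 1/2, which keeps the
    denominator of \<open>\<phi>\<close> away from 0. In the sum \<open>M\<close> at most one term
    is nonzero.\<close>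
  define N where "N = real (Suc d)"
  define m where "m s a = Min (a ` s)" for s and a :: "'v \<Rightarrow> real"
  define \<mu> where "\<mu> s t a = min (m s a) (t / (2 * N))" for s t a
  define M where "M a = (\<Sum>s\<in>H. m s a)" for a
  \<comment> \<open>\<open>\<phi> t\<close> stretches every removed facet radially from its barycentre by a factor of at most
    \<open>1 / (1 - t / 2)\<close>, stopping at the boundary. A point that reaches the boundary before time \<open>t\<close>
    is moved on by the contraction \<open>c\<close> for the remaining time \<open>t - 2 * N * M a\<close>.\<close>
  define \<phi> where "\<phi> t a = (\<lambda>w. (a w - (\<Sum>s\<in>H. \<mu> s t a * (if w \<in> s then 1 else 0)))
      / (1 - N * (\<Sum>s\<in>H. \<mu> s t a)))" for t a
  have N: "0 < N" by (simp add: N_def)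
  have fH: "finite H" by simp
  have core: "M a = 0 \<and> (\<forall>t\<ge>0. (\<forall>s\<in>H. \<mu> s t a = 0) \<and> \<phi> t a = a)" if "a \<in> ?A" for a
  proof -
    have m: "m s a = 0" if "s \<in> H" for s
      using barycentric_core_iff[of a] \<open>a \<in> ?A\<close> barycentric_core_subset that by (auto simp: m_def)
    then have "\<mu> s t a = 0" if "s \<in> H" "0 \<le> t" for s t using that N by (simp add: \<mu>_def)
    then show ?thesis using m by (simp add: M_def \<phi>_def)
  qed
  have facet: "M a = m s a \<and> (\<Sum>s\<in>H. \<mu> s t a) = \<mu> s t a
      \<and> \<phi> t a = (\<lambda>w. (a w - \<mu> s t a * (if w \<in> s then 1 else 0)) / (1 - N * \<mu> s t a))"
    if a: "a \<in> ?X" and s: "s \<in> H" "{v. a v \<noteq> 0} = s" and t: "0 \<le> t" for a s t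
  proof -
    have m: "m r a = 0" if "r \<in> H" "r \<noteq> s" for r
      using support_facet[OF a that(1)] s that(2) by (auto simp: m_def)
    then have \<mu>: "\<mu> r t a = 0" if "r \<in> H" "r \<noteq> s" for r using that t N by (simp add: \<mu>_def)
    have "M a = m s a" unfolding M_def by (rule sum_single[OF fH s(1)]) (rule m)
    moreover have "(\<Sum>s\<in>H. \<mu> s t a) = \<mu> s t a" by (rule sum_single[OF fH s(1)]) (rule \<mu>)
    moreover have "(\<Sum>r\<in>H. \<mu> r t a * (if w \<in> r then 1 else 0)) = \<mu> s t a * (if w \<in> s then 1 else 0)" for w
      by (rule sum_single[OF fH s(1)]) (simp add: \<mu>)
    ultimately show ?thesis by (simp add: \<phi>_def)
  qed
  have cases: thesis if "a \<in> ?X" "a \<in> ?A \<Longrightarrow> thesis" "\<And>s. s \<in> H \<Longrightarrow> {v. a v \<noteq> 0} = s \<Longrightarrow> thesis"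
    for a thesis using that by (auto simp: barycentric_iff)
  have N\<mu>: "N * \<mu> s t a \<le> 1 / 2" if "t \<le> 1" for s t a
  proof -
    have "\<mu> s t a \<le> 1 / (2 * N)" using that N by (auto simp: \<mu>_def divide_right_mono min.coboundedI2)
    then have "N * \<mu> s t a \<le> N * (1 / (2 * N))" using N by (intro mult_left_mono) auto
    then show ?thesis using N by simp
  qed
  have denom: "1 / 2 \<le> 1 - N * (\<Sum>s\<in>H. \<mu> s t a)" if t: "t \<in> {0..1}" and a: "a \<in> ?X" for t a
  proof (rule cases[OF a])
    assume "a \<in> ?A"
    then show ?thesis using core[of a] t by simp
  next
    fix s assume s: "s \<in> H" "{v. a v \<noteq> 0} = s"
    show ?thesis using facet[OF a s, of t] t N\<mu>[of t s a] by simp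
  qed
  have \<phi>X: "\<phi> t a \<in> ?X \<and> (2 * N * M a \<le> t \<longrightarrow> \<phi> t a \<in> ?A)" if t: "t \<in> {0..1}" and a: "a \<in> ?X" for t a
  proof (rule cases[OF a])
    assume "a \<in> ?A"
    then show ?thesis using core[of a] t a by simp
  next
    fix s assume s: "s \<in> H" "{v. a v \<noteq> 0} = s"
    have F: "\<phi> t a = (\<lambda>w. (a w - \<mu> s t a * (if w \<in> s then 1 else 0)) / (1 - N * \<mu> s t a))"
      and Mm: "M a = m s a" using facet[OF a s, of t] t by simp_all
    have D: "0 < 1 - N * \<mu> s t a" using N\<mu>[of t s a] t by simp
    have le: "\<mu> s t a \<le> a w" if "w \<in> s" for w
      using Min_image_le[OF that, of a] by (simp add: \<mu>_def m_def)
    have a0: "0 \<le> a w" for w using a by (simp add: barycentric_iff)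
    have nonneg: "0 \<le> \<phi> t a w" for w
      unfolding F using D le[of w] a0[of w] by (auto intro!: divide_nonneg_nonneg)
    have "(\<Sum>w\<in>UNIV. \<mu> s t a * (if w \<in> s then 1 else 0)) = \<mu> s t a * N"
      unfolding sum_distrib_left[symmetric] using card_H[OF s(1)] by (simp add: sum.If_cases N_def)
    then have "(\<Sum>w\<in>UNIV. \<phi> t a w) = (1 - \<mu> s t a * N) / (1 - N * \<mu> s t a)"
      using a unfolding F sum_divide_distrib[symmetric] sum_subtractf by (simp add: barycentric_iff)
    then have sum1: "(\<Sum>w\<in>UNIV. \<phi> t a w) = 1" using D by (simp add: mult.commute)
    have supp: "{w. \<phi> t a w \<noteq> 0} \<subseteq> s"
    proof
      fix w assume "w \<in> {w. \<phi> t a w \<noteq> 0}"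
      then show "w \<in> s" using s(2) by (cases "w \<in> s") (auto simp: F)
    qed
    then have K: "{w. \<phi> t a w \<noteq> 0} \<in> K" using down HK s(1) by blast
    \<comment> \<open>From this time on the cap in \<open>\<mu>\<close> is inactive: the full
      minimum is subtracted, and a vertex attaining it leaves the support.\<close>
    have "{w. \<phi> t a w \<noteq> 0} \<notin> H" if "2 * N * M a \<le> t"
    proof
      assume H: "{w. \<phi> t a w \<noteq> 0} \<in> H"
      have "{w. \<phi> t a w \<noteq> 0} = s"
        by (rule card_subset_eq[OF _ supp]) (use card_H[OF H] card_H[OF s(1)] in auto)
      moreover obtain w where w: "w \<in> s" "a w = Min (a ` s)" using Min_attained[OF s(1)] .
      moreover have "\<mu> s t a = m s a" using that Mm N by (simp add: \<mu>_def field_simps)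
      then have "\<phi> t a w = 0" using w by (simp add: F m_def)
      ultimately show False by auto
    qed
    then show ?thesis using nonneg sum1 K by (simp add: barycentric_iff)
  qed
  have M0: "0 \<le> M a" if "a \<in> ?X" for a
    unfolding M_def m_def using Min_nonneg[OF that] by (intro sum_nonneg) auto
  let ?Z = "{0..1::real} \<times> ?X"
  have ca: "continuous_on ?Z (\<lambda>z. snd z w)" for w
    by (rule continuous_on_coordinate[OF continuous_on_snd[OF continuous_on_id]])
  have cm: "continuous_on ?Z (\<lambda>z. m s (snd z))" if "s \<in> H" for s
    unfolding m_def
    by (rule continuous_on_Min_image[where f = "\<lambda>w z. snd z w"]) (use ca facet_nonempty[OF that] in simp_all)
  have c\<mu>: "continuous_on ?Z (\<lambda>z. \<mu> s (fst z) (snd z))" if "s \<in> H" for s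
    unfolding \<mu>_def using N by (intro continuous_on_min cm[OF that] continuous_on_divide
        continuous_on_fst continuous_on_id continuous_on_const) auto
  have cM: "continuous_on ?Z (\<lambda>z. M (snd z))"
    unfolding M_def by (intro continuous_on_sum cm)
  have c\<phi>: "continuous_on ?Z (\<lambda>z. \<phi> (fst z) (snd z))"
  proof (rule continuous_on_coordinatewise_then_product)
    fix w
    have "\<forall>z\<in>?Z. 1 - N * (\<Sum>s\<in>H. \<mu> s (fst z) (snd z)) \<noteq> 0" using denom by fastforce
    then show "continuous_on ?Z (\<lambda>z. \<phi> (fst z) (snd z) w)"
      unfolding \<phi>_def by (intro continuous_on_divide continuous_on_diff continuous_on_mult
          continuous_on_sum continuous_on_const c\<mu> ca)
  qed
  \<comment> \<open>At \<open>t = 2 * N * M a\<close> the point \<open>\<phi> t a\<close> has just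
    reached the subcomplex and \<open>c\<close> starts at time 0 as the identity, so the two
    branches agree. On the subcomplex \<open>M\<close> vanishes and \<open>\<phi> t\<close> is the
    identity, so \<open>h\<close> extends \<open>c\<close>.\<close>
  define h where "h z = (if fst z \<le> 2 * N * M (snd z) then \<phi> (fst z) (snd z)
      else c (fst z - 2 * N * M (snd z), \<phi> (fst z) (snd z)))" for z
  have cA: "c (t, a) \<in> ?A" if "t \<in> {0..1}" "a \<in> ?A" for t a using c(2) that by blast
  have "continuous_map (top_of_set ?Z) (top_of_set ?X) h"
    unfolding h_def
  proof (rule continuous_map_cases_le)
    show "continuous_map (top_of_set ?Z) euclideanreal fst"
      by (simp add: continuous_on_fst continuous_on_id)
    have "continuous_on ?Z (\<lambda>z. 2 * N * M (snd z))"
      by (intro continuous_on_mult continuous_on_const cM)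
    then show "continuous_map (top_of_set ?Z) euclideanreal (\<lambda>z. 2 * N * M (snd z))" by simp
    have "continuous_map (top_of_set ?Z) (top_of_set ?X) (\<lambda>z. \<phi> (fst z) (snd z))"
      using c\<phi> \<phi>X by auto
    then show "continuous_map (subtopology (top_of_set ?Z) {z \<in> topspace (top_of_set ?Z). fst z \<le> 2 * N * M (snd z)})
        (top_of_set ?X) (\<lambda>z. \<phi> (fst z) (snd z))"
      by (rule continuous_map_from_subtopology)
    let ?Y = "{z \<in> ?Z. 2 * N * M (snd z) \<le> fst z}"
    let ?g = "\<lambda>z. (fst z - 2 * N * M (snd z), \<phi> (fst z) (snd z))"
    have Y: "?Y \<subseteq> ?Z" by blast
    have "continuous_on ?Y ?g"
      by (intro continuous_on_Pair continuous_on_diff continuous_on_mult continuous_on_const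
          continuous_on_subset[OF cM Y] continuous_on_subset[OF c\<phi> Y] continuous_on_fst continuous_on_id)
    moreover have gY: "?g ` ?Y \<subseteq> {0..1} \<times> ?A"
    proof
      fix y assume "y \<in> ?g ` ?Y"
      then obtain t a where ta: "t \<in> {0..1}" "a \<in> ?X" "2 * N * M a \<le> t" "y = (t - 2 * N * M a, \<phi> t a)" by auto
      moreover have "0 \<le> 2 * N * M a" using M0[OF ta(2)] N by simp
      ultimately show "y \<in> {0..1} \<times> ?A" using \<phi>X[OF ta(1,2)] by auto
    qed
    ultimately have "continuous_on ?Y (\<lambda>z. c (?g z))"
      by (intro continuous_on_compose2[OF c(1)])
    moreover have "(\<lambda>z. c (?g z)) ` ?Y \<subseteq> ?X"
    proof
      fix y assume "y \<in> (\<lambda>z. c (?g z)) ` ?Y"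
      then obtain z where "z \<in> ?Y" "y = c (?g z)" by blast
      then have "y \<in> c ` ({0..1} \<times> ?A)" using gY by blast
      then show "y \<in> ?X" using c(2) barycentric_core_subset by blast
    qed
    ultimately have "continuous_map (top_of_set ?Y) (top_of_set ?X) (\<lambda>z. c (?g z))" by auto
    moreover have "subtopology (top_of_set ?Z) {z \<in> topspace (top_of_set ?Z). 2 * N * M (snd z) \<le> fst z}
        = top_of_set ?Y"
      unfolding subtopology_subtopology by (rule arg_cong[where f = top_of_set]) auto
    ultimately show "continuous_map (subtopology (top_of_set ?Z) {z \<in> topspace (top_of_set ?Z). 2 * N * M (snd z) \<le> fst z})
        (top_of_set ?X) (\<lambda>z. c (?g z))" by (simp only:)
    fix z assume "z \<in> topspace (top_of_set ?Z)" "fst z = 2 * N * M (snd z)"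
    then show "\<phi> (fst z) (snd z) = c (?g z)" using \<phi>X[of "fst z" "snd z"] c(3) by auto
  qed
  moreover have "h (0, a) = a" if "a \<in> ?X" for a
  proof -
    have "\<mu> s 0 a = 0" if "s \<in> H" for s
      using Min_nonneg[OF \<open>a \<in> ?X\<close> that] by (simp add: \<mu>_def m_def)
    then have "\<phi> 0 a = a" by (simp add: \<phi>_def)
    then show ?thesis using M0[OF that] N by (simp add: h_def)
  qed
  moreover have hA: "h (t, a) = (if t \<le> 0 then a else c (t, a))" if "t \<in> {0..1}" "a \<in> ?A" for t a
    using core[OF that(2)] that(1) by (simp add: h_def)
  moreover have "h (t, a) \<in> ?A" if "t \<in> {0..1}" "a \<in> ?A" for t a
    using hA[OF that] cA[OF that] that(2) by simp
  moreover have "h (1, a) = x0" if "a \<in> ?A" for a using hA[OF _ that, of 1] c(4) that by simp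
  ultimately show ?thesis by (intro exI[of _ h] exI[of _ x0]) simp
qed

end

lemma bij_betw_lessThan_ball:
  fixes n :: nat
  assumes "bij_betw e {..<n} H"
  shows "(\<forall>s\<in>H. P s) \<longleftrightarrow> (\<forall>i<n. P (e i))"
proof -
  have "H = e ` {..<n}" using assms by (simp add: bij_betw_def)
  then show ?thesis by auto
qed

section \<open>The quotient map onto the wedge of spheres\<close>

context facet_removal begin

text \<open>The map \<open>f\<close> sends the interior of the facet \<open>e i\<close> bijectively
  onto sphere \<open>i\<close> without its base point, and the remaining subcomplex to
  \<open>None\<close>. Thus \<open>f\<close> identifies exactly the points of a subspace that
  \<open>h\<close> contracts.\<close>

lemma homotopy_equivalent_wedge_of_spheres:
  assumes contr: "contractible (barycentric (K - H))" and ne: "barycentric (K - H) \<noteq> {}"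
  shows "geometric_realization K homotopy_equivalent_space wedge_of_spheres (card H) d"
proof -
  let ?A = "barycentric (K - H)" and ?X = "barycentric K" and ?n = "card H"
  define base :: "nat \<Rightarrow> real" where "base = (\<lambda>i. if i = 0 then 1 else 0)"
  define W where "W = wedge (\<lambda>_::nat. nsphere d) (\<lambda>_. base) {..<?n}"
  have W: "wedge_of_spheres ?n d = W" by (simp add: wedge_of_spheres_def W_def base_def)
  obtain h x0 where h:
    "continuous_map (prod_topology (top_of_set {0..1::real}) (top_of_set ?X)) (top_of_set ?X) h"
    "\<forall>a\<in>?X. h (0, a) = a" "\<forall>t\<in>{0..1}. \<forall>a\<in>?A. h (t, a) \<in> ?A" "\<forall>a\<in>?A. h (1, a) = x0"
    using homotopy_extension[OF contr] by blast
  obtain e where e: "bij_betw e {..<?n} H"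
    using ex_bij_betw_nat_finite[of H] by (auto simp: atLeast0LessThan)
  have eH: "e i \<in> H" if "i < ?n" for i using e that by (auto simp: bij_betw_def)
  have "\<exists>g. bij_betw g {..d} s" if "s \<in> H" for s
  proof -
    have "{0..<card s} = {..d}" using card_H[OF that] by auto
    then show ?thesis using ex_bij_betw_nat_finite[of s] by auto
  qed
  \<comment> \<open>A numbering of the vertices of each facet, so that the formulas for the standard
    simplex apply through \<open>b\<close>.\<close>
  then obtain v where v: "\<And>s. s \<in> H \<Longrightarrow> bij_betw (v s) {..d} s" by metis
  define b where "b i a = (\<lambda>j. a (v (e i) j))" for i and a :: "'v \<Rightarrow> real"
  define q where "q i a = simplex_to_sphere d (b i a)" for i a
  have img: "b i a ` {..d} = a ` e i" if "i < ?n" for i a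
    using v[OF eH[OF that]] unfolding b_def bij_betw_def by (metis image_image)
  have sum_b: "(\<Sum>j\<le>d. b i a j) = sum a (e i)" if "i < ?n" for i a
    unfolding b_def by (rule sum.reindex_bij_betw[OF v[OF eH[OF that]]])
  have b0: "0 \<le> b i a j" if "a \<in> ?X" for i a j using that by (simp add: b_def barycentric_iff)
  have q_base: "q i a = base \<longleftrightarrow> Min (a ` e i) = 0" if "i < ?n" "a \<in> ?X" for i a
    using simplex_to_sphere_base[of "b i a" d] simplex_to_sphere_not_base[of d "b i a"] b0[OF that(2)]
    unfolding q_def base_def img[OF that(1)] by blast
  have supp: "{v. a v \<noteq> 0} = e i" if "i < ?n" "a \<in> ?X" "q i a \<noteq> base" for i a
    using support_facet[OF that(2) eH[OF that(1)]] q_base[OF that(1,2)] that(3) by blast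
  have sum1: "sum a (e i) = 1" if "i < ?n" "a \<in> ?X" "q i a \<noteq> base" for i a
    using supp[OF that] that(2) by (simp add: barycentric_def)
  have uniq: "i = j" if "i < ?n" "j < ?n" "a \<in> ?X" "q i a \<noteq> base" "q j a \<noteq> base" for i j a
    using supp[OF that(1,3,4)] supp[OF that(2,3,5)] e that(1,2) by (auto simp: bij_betw_def inj_on_def)
  have core: "a \<in> ?A \<longleftrightarrow> (\<forall>i<?n. q i a = base)" if a: "a \<in> ?X" for a
  proof -
    have "(\<forall>s\<in>H. Min (a ` s) = 0) \<longleftrightarrow> (\<forall>i<?n. Min (a ` e i) = 0)"
      by (rule bij_betw_lessThan_ball[OF e])
    also have "\<dots> \<longleftrightarrow> (\<forall>i<?n. q i a = base)" using q_base[OF _ a] by simp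
    finally show ?thesis using barycentric_core_iff[OF a] by (rule trans[rotated])
  qed
  have q_sphere: "q i a \<in> topspace (nsphere d)" if "i < ?n" "a \<in> ?X" for i a
    unfolding q_def
  proof (rule simplex_to_sphere_in_nsphere)
    have "Min (a ` e i) = 0 \<or> sum a (e i) = 1"
      using sum1[OF that] q_base[OF that] by (cases "q i a = base") simp_all
    then show "Min (b i a ` {..d}) = 0 \<or> (\<Sum>j\<le>d. b i a j) = 1"
      by (simp only: img[OF that(1)] sum_b[OF that(1)])
  qed (rule b0[OF that(2)])
  have q_cont: "continuous_map (top_of_set ?X) (nsphere d) (q i)" if "i < ?n" for i
  proof -
    have "continuous_on ?X (q i)"
      unfolding q_def
      by (rule continuous_on_simplex_to_sphere)
         (auto simp: b_def barycentric_iff intro!: continuous_on_coordinate continuous_on_id)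
    then show ?thesis
      using q_sphere[OF that] by (auto simp: nsphere euclidean_product_topology)
  qed
  \<comment> \<open>By \<open>uniq\<close> at most one \<open>q i a\<close> leaves the base point,
    which makes the description by \<open>THE\<close> meaningful.\<close>
  define f where "f a = (if \<exists>i<?n. q i a \<noteq> base then
      (let i = (THE i. i < ?n \<and> q i a \<noteq> base) in Some (i, q i a)) else None)" for a
  have f_Some: "f a = Some (i, q i a)" if "a \<in> ?X" "i < ?n" "q i a \<noteq> base" for a i
  proof -
    have "(THE i. i < ?n \<and> q i a \<noteq> base) = i" using uniq that by (intro the_equality) auto
    then show ?thesis using that by (auto simp: f_def)
  qed
  have f_None: "f a = None" if "\<And>i. i < ?n \<Longrightarrow> q i a = base" for a
    using that by (auto simp: f_def)
  have base: "base \<in> topspace (nsphere d)" unfolding base_def by (rule in_topspace_nsphere)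
  have f_cont: "continuous_map (top_of_set ?X) W f"
    unfolding W_def
    by (rule continuous_map_into_wedge[where q = q]) (use q_cont base f_Some f_None in auto)
  have f_onto: "f ` topspace (top_of_set ?X) = topspace W"
  proof
    show "f ` topspace (top_of_set ?X) \<subseteq> topspace W"
      using f_cont by (rule continuous_map_image_subset_topspace)
    show "topspace W \<subseteq> f ` topspace (top_of_set ?X)"
    proof
      fix y assume "y \<in> topspace W"
      then consider "y = None" | i x where "i < ?n" "x \<in> topspace (nsphere d)" "x \<noteq> base" "y = Some (i, x)"
        unfolding W_def topspace_wedge by (auto simp: wedge_proj_def split: if_splits)
      then show "y \<in> f ` topspace (top_of_set ?X)"
      proof cases
        case 1
        \<comment> \<open>The point \<open>None\<close> belongs to the wedge even if no facet is
          removed; the nonempty subcomplex provides its preimage.\<close>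
        obtain a where a: "a \<in> ?A" using ne by blast
        then have "a \<in> ?X" using barycentric_core_subset by blast
        moreover have "f a = None" using core[of a] a \<open>a \<in> ?X\<close> by (intro f_None) auto
        ultimately show ?thesis using 1 by force
      next
        case 2
        obtain c where c: "\<And>j. j \<le> d \<Longrightarrow> 0 < c j" "(\<Sum>j\<le>d. c j) = 1" "simplex_to_sphere d c = x"
          using simplex_to_sphere_surj[OF 2(2)] 2(3) unfolding base_def by blast
        have vi: "bij_betw (v (e i)) {..d} (e i)" by (rule v[OF eH[OF 2(1)]])
        define a where "a w = (if w \<in> e i then c (inv_into {..d} (v (e i)) w) else 0)" for w
        have av: "a (v (e i) j) = c j" if "j \<le> d" for j
          using vi that by (auto simp: a_def bij_betw_def inv_into_f_f)
        have pos: "0 < a w" if "w \<in> e i" for w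
        proof -
          have "inv_into {..d} (v (e i)) w \<in> {..d}"
            using vi that by (metis bij_betw_def inv_into_into)
          then show ?thesis using c(1) that by (simp add: a_def)
        qed
        have "{w. a w \<noteq> 0} = e i" using pos by (force simp: a_def)
        moreover have "sum a (e i) = 1"
          using sum_b[OF 2(1), of a] av c(2) by (simp add: b_def)
        moreover have "0 \<le> a w" for w using pos[of w] by (cases "w \<in> e i") (auto simp: a_def)
        ultimately have a: "a \<in> ?X" using eH[OF 2(1)] HK by (auto simp: barycentric_def)
        have "simplex_to_sphere d (b i a) = simplex_to_sphere d c"
        proof -
          have bc: "b i a j = c j" if "j \<le> d" for j using av[OF that] by (simp add: b_def)
          then have "b i a ` {..d} = c ` {..d}" by simp
          moreover have "simplex_denominator d (b i a) = simplex_denominator d c"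
            using bc by (simp add: simplex_denominator_def)
          ultimately show ?thesis using bc by (auto simp: simplex_to_sphere_def fun_eq_iff)
        qed
        then have "q i a = x" using c(3) by (simp add: q_def)
        then have "f a = y" using f_Some[OF a 2(1)] 2(3,4) by simp
        then show ?thesis using a by force
      qed
    qed
  qed
  have compact: "compact_space (top_of_set ?X)"
    using compact_barycentric[OF down] by (simp add: compact_space_subtopology)
  have Hausdorff: "Hausdorff_space W"
    unfolding W_def
    by (rule Hausdorff_space_wedge) (use base in \<open>auto simp: nsphere euclidean_product_topology Hausdorff_space_subtopology\<close>)
  have sub: "?A \<subseteq> topspace (top_of_set ?X)" using barycentric_core_subset by simp
  have f_core: "f a = None" if "a \<in> ?A" for a
    using core[of a] that barycentric_core_subset by (intro f_None) auto
  have f_inj: "a = a' \<or> a \<in> ?A \<and> a' \<in> ?A"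
    if aa: "a \<in> topspace (top_of_set ?X)" "a' \<in> topspace (top_of_set ?X)" "f a = f a'" for a a'
  proof -
    have X: "a \<in> ?X" "a' \<in> ?X" using aa by simp_all
    have in_core: "c \<in> ?A" if c: "c \<in> ?X" "f c = None" for c
    proof -
      have "q i c = base" if "i < ?n" for i using f_Some[OF c(1) that] c(2) by fastforce
      then show ?thesis using core[OF c(1)] by simp
    qed
    show ?thesis
    proof (cases "f a")
      case None
      then show ?thesis using in_core X aa(3) by simp
    next
      case (Some y)
      have "\<exists>i<?n. q i a \<noteq> base"
      proof (rule ccontr)
        assume "\<not> ?thesis"
        then have "f a = None" by (intro f_None) blast
        then show False using Some by simp
      qed
      then obtain i where i: "i < ?n" "q i a \<noteq> base" by blast
      have "\<exists>j<?n. q j a' \<noteq> base"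
      proof (rule ccontr)
        assume "\<not> ?thesis"
        then have "f a' = None" by (intro f_None) blast
        then show False using Some aa(3) by simp
      qed
      then obtain j where j: "j < ?n" "q j a' \<noteq> base" by blast
      have ij: "j = i" "q i a = q i a'"
        using f_Some[OF X(1) i] f_Some[OF X(2) j] aa(3) by auto
      have i': "q i a' \<noteq> base" using j ij by simp
      have bb: "b i a k = b i a' k" if "k \<le> d" for k
      proof (rule simplex_to_sphere_inj[where d = d])
        show "simplex_to_sphere d (b i a) = simplex_to_sphere d (b i a')" using ij(2) by (simp add: q_def)
        show "Min (b i a ` {..d}) \<noteq> 0" "Min (b i a' ` {..d}) \<noteq> 0"
          using q_base[OF i(1)] X i(2) i' unfolding img[OF i(1)] by blast+
        show "(\<Sum>j\<le>d. b i a j) = 1" "(\<Sum>j\<le>d. b i a' j) = 1"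
          unfolding sum_b[OF i(1)] using sum1[OF i(1)] X i(2) i' by blast+
      qed (use b0 X that in auto)
      have on: "a w = a' w" if w: "w \<in> e i" for w
      proof -
        have "w \<in> v (e i) ` {..d}" using w bij_betw_imp_surj_on[OF v[OF eH[OF i(1)]]] by simp
        then obtain k where "k \<le> d" "w = v (e i) k" by auto
        then show ?thesis using bb[of k] by (simp add: b_def)
      qed
      have off: "a w = 0 \<and> a' w = 0" if "w \<notin> e i" for w
        using that supp[OF i(1) X(1) i(2)] supp[OF i(1) X(2) i'] by auto
      have "a w = a' w" for w using on[of w] off[of w] by (cases "w \<in> e i") simp_all
      then have "a = a'" by (rule ext)
      then show ?thesis by simp
    qed
  qed
  have "top_of_set ?X homotopy_equivalent_space W"
  proof (rule homotopy_equivalent_collapse[OF compact Hausdorff f_cont f_onto sub f_core f_inj h(1)])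
    show "h (0, a) = a" if "a \<in> topspace (top_of_set ?X)" for a using h(2) that by simp
    show "h (t, a) \<in> ?A" if "t \<in> {0..1}" "a \<in> ?A" for t a using h(3) that by blast
    show "h (1, a) = x0" if "a \<in> ?A" for a using h(4) that by blast
  qed
  then show ?thesis unfolding W geometric_realization_barycentric .
qed

end

subsection \<open>Counting independent sets\<close>

theorem matroid_homotopy_equivalent_wedge:
  fixes I :: "'v::finite set set"
  assumes M: "matroid I (Suc d)"
  shows "\<exists>m. real m = (-1) ^ Suc d * (\<Sum>s\<in>I. (-1) ^ card s) \<and>
    geometric_realization I homotopy_equivalent_space wedge_of_spheres m d"
proof -
  have down: "t \<in> I" if "s \<in> I" "t \<subseteq> s" for s t using M that unfolding matroid_def by blast
  have le: "card s \<le> Suc d" if "s \<in> I" for s using M that unfolding matroid_def by blast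
  obtain H where H: "H \<subseteq> I" "\<And>s. s \<in> H \<Longrightarrow> card s = Suc d" "collapsible (I - H)"
    using matroid_collapsible[OF M] by metis
  interpret facet_removal I H d
  proof
    show "t \<in> I" if "s \<in> I" "t \<subseteq> s" for s t using that by (rule down)
    show "H \<subseteq> I" by (rule H(1))
    show "card s = Suc d" if "s \<in> H" for s using that by (rule H(2))
    show "card s \<le> Suc d" if "s \<in> I" for s using that by (rule le)
  qed
  obtain s where "s \<in> I" using M unfolding matroid_def by blast
  then have "{} \<in> I" using down by blast
  \<comment> \<open>The rank is positive, so the empty face is not among the removed bases; the
    remaining family is therefore not void and has a vertex.\<close>
  moreover have "{} \<notin> H" using H(2) by fastforce
  ultimately have "I - H \<noteq> {}" by blast
  then obtain v where "{v} \<in> I - H" using collapsible_has_vertex[OF H(3)] by blast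
  then have "(\<lambda>w. if w = v then 1 else 0) \<in> barycentric (I - H)" by (rule barycentric_vertex)
  then have "barycentric (I - H) \<noteq> {}" by blast
  then have hom: "geometric_realization I homotopy_equivalent_space wedge_of_spheres (card H) d"
    by (rule homotopy_equivalent_wedge_of_spheres[OF contractible_barycentric_collapsible[OF H(3)]])
  have "(\<Sum>s\<in>I. (-1) ^ card s) = (\<Sum>s\<in>I - H. (-1) ^ card s) + (\<Sum>s\<in>H. (-1::real) ^ card s)"
    by (rule sum.subset_diff[OF H(1)]) simp
  moreover have "(\<Sum>s\<in>H. (-1::real) ^ card s) = (\<Sum>s\<in>H. (-1) ^ Suc d)"
    by (rule sum.cong[OF refl]) (simp only: H(2))
  ultimately have "(\<Sum>s\<in>I. (-1::real) ^ card s) = real (card H) * (-1) ^ Suc d"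
    using collapsible_euler[OF H(3)] by simp
  then have "real (card H) = (-1) ^ Suc d * (\<Sum>s\<in>I. (-1) ^ card s)" by simp
  with hom show ?thesis by blast
qed

text \<open>Double counting of the pairs of an independent set with \<open>Suc i\<close> elements
  and a member of it: removing the member leaves an independent set of size \<open>i\<close>
  together with one of its \<open>N\<close> extensions.\<close>

lemma card_extensions:
  assumes I: "finite I" "\<And>s. s \<in> I \<Longrightarrow> finite s" "\<And>s t. s \<in> I \<Longrightarrow> t \<subseteq> s \<Longrightarrow> t \<in> I"
    and N: "\<And>s. s \<in> I \<Longrightarrow> card s = i \<Longrightarrow> card {x. x \<notin> s \<and> insert x s \<in> I} = N"
  shows "Suc i * card {s \<in> I. card s = Suc i} = card {s \<in> I. card s = i} * N"
proof -
  let ?P = "SIGMA s:{s \<in> I. card s = i}. {x. x \<notin> s \<and> insert x s \<in> I}"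
  let ?Q = "SIGMA t:{t \<in> I. card t = Suc i}. t"
  have fin: "finite {x. x \<notin> s \<and> insert x s \<in> I}" for s
    by (rule finite_subset[of _ "\<Union>I"]) (use I in auto)
  have "bij_betw (\<lambda>(s, x). (insert x s, x)) ?P ?Q"
  proof (rule bij_betw_byWitness[where f' = "\<lambda>(t, x). (t - {x}, x)"])
    show "\<forall>a\<in>?P. (\<lambda>(t, x). (t - {x}, x)) ((\<lambda>(s, x). (insert x s, x)) a) = a" by auto
    show "\<forall>a\<in>?Q. (\<lambda>(s, x). (insert x s, x)) ((\<lambda>(t, x). (t - {x}, x)) a) = a" by auto
    show "(\<lambda>(s, x). (insert x s, x)) ` ?P \<subseteq> ?Q" using I(2) by auto
    show "(\<lambda>(t, x). (t - {x}, x)) ` ?Q \<subseteq> ?P"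
    proof
      fix y assume "y \<in> (\<lambda>(t, x). (t - {x}, x)) ` ?Q"
      then obtain t x where t: "t \<in> I" "card t = Suc i" "x \<in> t" "y = (t - {x}, x)" by auto
      moreover have "t - {x} \<in> I" using I(3)[OF t(1)] by blast
      moreover have "insert x (t - {x}) = t" using t(3) by blast
      ultimately show "y \<in> ?P" by simp
    qed
  qed
  then have "card ?P = card ?Q" by (rule bij_betw_same_card)
  moreover have "card ?P = card {s \<in> I. card s = i} * N"
    using I(1) fin N by (subst card_SigmaI) auto
  moreover have "card ?Q = card {t \<in> I. card t = Suc i} * Suc i"
    using I(1,2) by (subst card_SigmaI) auto
  ultimately show ?thesis by simp
qed

text \<open>Repeated extension builds each independent set of size \<open>i\<close> in
  \<open>fact i\<close> orders, so there are \<open>(\<Prod>j<i. N j) / fact i\<close> of them.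
  Grouping the alternating sum by cardinality gives the formula; the empty set yields the leading
  term.\<close>

lemma matroid_euler:
  assumes M: "matroid I r"
    and N: "\<And>s. s \<in> I \<Longrightarrow> card s < r \<Longrightarrow> real (card {x. x \<notin> s \<and> insert x s \<in> I}) = N (card s)"
  shows "(-1) ^ r * (\<Sum>s\<in>I. (-1) ^ card s) =
    (-1) ^ r + (\<Sum>i<r. (-1) ^ (r - 1 - i) * (\<Prod>j\<le>i. N j) / fact (i + 1))"
proof -
  have I: "finite I" "\<And>s. s \<in> I \<Longrightarrow> finite s" "\<And>s t. s \<in> I \<Longrightarrow> t \<subseteq> s \<Longrightarrow> t \<in> I"
    and le: "\<And>s. s \<in> I \<Longrightarrow> card s \<le> r" and ex: "\<exists>s\<in>I. card s = r"
    using M unfolding matroid_def by blast+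
  define f where "f i = card {s \<in> I. card s = i}" for i
  have "{s \<in> I. card s = 0} = {{}}" using ex I by (auto dest: I(3)[of _ "{}"])
  then have f0: "f 0 = 1" by (simp add: f_def)
  have f: "real (f i) = (\<Prod>j<i. N j) / fact i" if "i \<le> r" for i
    using that
  proof (induction i)
    case (Suc i)
    define N' where "N' t = card {x. x \<notin> t \<and> insert x t \<in> I}" for t
    have ext: "real (Suc i) * real (f (Suc i)) = real (f i) * N i"
    \<comment> \<open>\<open>card_extensions\<close> wants a natural number while \<open>N i\<close>
      is real, so the count \<open>N' t\<close> at one independent set \<open>t\<close> of size
      \<open>i\<close> stands in for it. Without such a set both sides are 0.\<close>
    proof (cases "f i = 0")
      case True
      have "{s \<in> I. card s = Suc i} = {}"
      proof (rule ccontr)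
        assume "\<not> ?thesis"
        then obtain s where s: "s \<in> I" "card s = Suc i" by blast
        then obtain x where "x \<in> s" by fastforce
        then have "s - {x} \<in> {s \<in> I. card s = i}" using s I(3)[OF s(1), of "s - {x}"] by auto
        then show False using True I(1) by (auto simp: f_def)
      qed
      then have "f (Suc i) = 0" by (simp only: f_def card.empty)
      then show ?thesis using True by simp
    next
      case False
      then have "{s \<in> I. card s = i} \<noteq> {}" unfolding f_def by (metis card.empty)
      then obtain t where t: "t \<in> I" "card t = i" by blast
      have eq: "N' s = N' t" if "s \<in> I" "card s = i" for s
        using N[of s] N[of t] that t Suc.prems by (simp add: N'_def)
      have "Suc i * f (Suc i) = f i * N' t"
        unfolding f_def
      proof (rule card_extensions[OF I(1)])
        show "finite s" if "s \<in> I" for s using that by (rule I(2))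
        show "u \<in> I" if "s \<in> I" "u \<subseteq> s" for s u using that by (rule I(3))
        show "card {x. x \<notin> s \<and> insert x s \<in> I} = N' t" if "s \<in> I" "card s = i" for s
          using eq[OF that] by (simp only: N'_def)
      qed
      then have "real (Suc i * f (Suc i)) = real (f i * N' t)" by (rule arg_cong)
      moreover have "real (N' t) = N i" using N[OF t(1)] t(2) Suc.prems by (simp add: N'_def)
      ultimately show ?thesis by (simp only: of_nat_mult)
    qed
    have "real (f (Suc i)) = real (f i) * N i / real (Suc i)"
      using ext by (simp add: field_simps del: of_nat_Suc)
    then show ?case using Suc by (simp add: field_simps)
  qed (simp add: f0)
  have "(\<Sum>s\<in>I. (-1) ^ card s) = (\<Sum>i\<le>r. \<Sum>s | s \<in> I \<and> card s = i. (-1::real) ^ card s)"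
    by (rule sum.group[symmetric]) (use I le in auto)
  also have "\<dots> = (\<Sum>i\<le>r. (-1) ^ i * real (f i))"
    by (rule sum.cong[OF refl]) (simp add: f_def)
  also have "\<dots> = 1 + (\<Sum>i<r. (-1) ^ Suc i * real (f (Suc i)))"
    unfolding sum.atMost_shift by (simp add: f0)
  finally have "(-1) ^ r * (\<Sum>s\<in>I. (-1) ^ card s) =
      (-1) ^ r + (\<Sum>i<r. (-1) ^ r * ((-1) ^ Suc i * real (f (Suc i))))"
    by (simp only: distrib_left sum_distrib_left mult_1_right)
  also have "(\<Sum>i<r. (-1) ^ r * ((-1) ^ Suc i * real (f (Suc i)))) =
      (\<Sum>i<r. (-1) ^ (r - 1 - i) * (\<Prod>j\<le>i. N j) / fact (i + 1))"
  proof (rule sum.cong)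
    fix i assume "i \<in> {..<r}"
    then have i: "i < r" by simp
    \<comment> \<open>The exponents \<open>r + Suc i\<close> and \<open>r - 1 - i\<close> have the
      same parity.\<close>
    have "r + Suc i = (r - 1 - i) + 2 * Suc i" using i by simp
    then have "(-1::real) ^ r * (-1) ^ Suc i = (-1) ^ (r - 1 - i)"
      by (metis power_add power_mult power_minus1_even mult_1_right power_one power2_minus)
    then show "(-1) ^ r * ((-1) ^ Suc i * real (f (Suc i))) =
        (-1) ^ (r - 1 - i) * (\<Prod>j\<le>i. N j) / fact (i + 1)"
      using f[of "Suc i"] i by (simp add: lessThan_Suc_atMost mult.assoc[symmetric] del: power_Suc)
  qed simp
  finally show ?thesis .
qed

subsection \<open>Independent vectors and lines over a finite field\<close>

text \<open>A new independent vector \<open>a\<close> multiplies the size of the span by the size of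
  the field, as each vector has a unique form \<open>k *s a + u\<close> with \<open>u\<close> in the
  old span.\<close>

lemma card_span_independent:
  fixes S :: "('k::{field,finite} ^ 'n) set"
  assumes "vec.independent S"
  shows "card (vec.span S) = CARD('k) ^ card S"
proof -
  have "finite S" using assms by (rule vec.finiteI_independent)
  then show ?thesis using assms
  proof (induction S rule: finite_induct)
    case (insert a S)
    then have ind: "vec.independent S" "a \<notin> vec.span S"
      by (simp_all add: vec.independent_insert)
    let ?g = "\<lambda>(k::'k, u). k *s a + u"
    have "vec.span (insert a S) = ?g ` (UNIV \<times> vec.span S)"
    proof (intro equalityI subsetI)
      fix x assume "x \<in> vec.span (insert a S)"
      then obtain k where "x - k *s a \<in> vec.span S" unfolding vec.span_insert by blast
      then show "x \<in> ?g ` (UNIV \<times> vec.span S)"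
        by (intro image_eqI[of _ _ "(k, x - k *s a)"]) auto
    next
      fix x assume "x \<in> ?g ` (UNIV \<times> vec.span S)"
      then obtain k u where "x = k *s a + u" "u \<in> vec.span S" by auto
      then have "x - k *s a \<in> vec.span S" by simp
      then show "x \<in> vec.span (insert a S)" unfolding vec.span_insert by blast
    qed
    moreover have "inj_on ?g (UNIV \<times> vec.span S)"
    proof (rule inj_onI, clarify)
      fix k u k' u' assume u: "u \<in> vec.span S" "u' \<in> vec.span S" and eq: "k *s a + u = k' *s a + u'"
      have *: "(k - k') *s a = u' - u" using eq by (simp add: vec.scale_left_diff_distrib algebra_simps)
      then have "(k - k') *s a \<in> vec.span S" using u by (simp add: vec.span_diff)
      \<comment> \<open>If the two scalars differed, dividing by their difference would put
        \<open>a\<close> into the span of \<open>S\<close>.\<close>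
      then have "inverse (k - k') *s ((k - k') *s a) \<in> vec.span S" by (rule vec.span_scale)
      then have "(inverse (k - k') * (k - k')) *s a \<in> vec.span S" by (simp only: vec.scale_scale)
      then have "k = k'" using ind(2) by (cases "k = k'") (simp_all only: left_inverse vec.scale_one right_minus_eq not_False_eq_True)
      then show "k = k' \<and> u = u'" using eq by simp
    qed
    ultimately have "card (vec.span (insert a S)) = card ((UNIV :: 'k set) \<times> vec.span S)"
      by (simp add: card_image)
    then show ?case using insert ind by (simp add: card_cartesian_product)
  qed (simp add: vec.span_empty)
qed

lemma independent_exchange:
  fixes S T :: "('k::{field,finite} ^ 'n) set"
  assumes S: "vec.independent S" and T: "vec.independent T" and "card S < card T"
  obtains x where "x \<in> T" "x \<notin> vec.span S"
proof -
  have "\<not> T \<subseteq> vec.span S"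
    using vec.independent_span_bound[OF vec.finiteI_independent[OF S] T] assms(3) by auto
  then show thesis using that by blast
qed

section \<open>The matroid of vectors\<close>

lemma matroid_X_complex: "matroid (X_complex :: ('k::{field,finite} ^ 'n) set set) CARD('n)"
  unfolding matroid_def
proof (intro conjI ballI allI impI)
  fix s :: "('k ^ 'n) set" assume s: "s \<in> X_complex"
  then show "card s \<le> CARD('n)"
    using vec.independent_card_le_dim[of s UNIV] by (simp add: X_complex_def card_cart_basis)
  show "t \<in> X_complex" if "t \<subseteq> s" for t
    using s that vec.independent_mono by (auto simp: X_complex_def)
  show "\<exists>x\<in>t - s. insert x s \<in> X_complex" if t: "t \<in> X_complex" "card s < card t" for t
  proof -
    obtain x where x: "x \<in> t" "x \<notin> vec.span s"
      using independent_exchange s t unfolding X_complex_def by blast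
    then have "vec.independent (insert x s)" using s by (simp add: X_complex_def vec.independent_insertI)
    then show ?thesis using x vec.span_base by (auto simp: X_complex_def)
  qed
next
  show "\<exists>s\<in>X_complex :: ('k ^ 'n) set set. card s = CARD('n)"
    using card_cart_basis vec.independent_Basis unfolding X_complex_def by blast
qed simp_all

text \<open>The admissible new vectors are those outside the span of \<open>s\<close>, whose size is
  known.\<close>

lemma card_X_complex_extensions:
  fixes s :: "('k::{field,finite} ^ 'n) set"
  assumes "s \<in> X_complex"
  shows "real (card {x. x \<notin> s \<and> insert x s \<in> X_complex}) = real CARD('k) ^ CARD('n) - real CARD('k) ^ card s"
proof -
  have s: "vec.independent s" using assms by (simp add: X_complex_def)
  have "{x. x \<notin> s \<and> insert x s \<in> X_complex} = UNIV - vec.span s"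
    using s vec.span_base[of _ s] by (auto simp: X_complex_def vec.independent_insert)
  then have "card {x. x \<notin> s \<and> insert x s \<in> X_complex} = CARD('k) ^ CARD('n) - CARD('k) ^ card s"
    using s by (simp add: card_Diff_subset card_span_independent CARD_vec)
  moreover have "CARD('k) ^ card s \<le> CARD('k) ^ CARD('n)"
    using card_mono[of UNIV "vec.span s"] s by (simp add: card_span_independent CARD_vec)
  ultimately show ?thesis by simp
qed


section \<open>The matroid of lines\<close>

lemma lines_eq_span:
  fixes l :: "('k::field ^ 'n) set"
  assumes l: "l \<in> lines" and v: "v \<in> l" "v \<noteq> 0"
  shows "l = vec.span {v}"
proof -
  have sub: "vec.span {v} \<subseteq> l" using l v(1) by (intro vec.span_minimal) (auto simp: lines_def)
  then show ?thesis
    using vec.subspace_dim_equal[OF vec.subspace_span, of l "{v}"] l v(2) by (simp add: lines_def)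
qed

lemma span_singleton_lines: "v \<noteq> 0 \<Longrightarrow> vec.span {v} \<in> lines" for v :: "'k::field ^ 'n"
  by (simp add: lines_def)

definition line_rep :: "('k::field ^ 'n) set \<Rightarrow> 'k ^ 'n" where
  "line_rep l = (SOME v. v \<in> l \<and> v \<noteq> 0)"

lemma line_rep:
  assumes "l \<in> lines"
  shows "line_rep l \<in> l" "line_rep l \<noteq> 0"
proof -
  have "\<exists>v. v \<in> l \<and> v \<noteq> 0" using assms vec.dim_eq_0[of l] by (auto simp: lines_def)
  then have "line_rep l \<in> l \<and> line_rep l \<noteq> 0" unfolding line_rep_def by (rule someI_ex)
  then show "line_rep l \<in> l" "line_rep l \<noteq> 0" by simp_all
qed

lemma span_line_rep:
  assumes "l \<in> lines"
  shows "l = vec.span {line_rep l}"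
  by (rule lines_eq_span[OF assms line_rep[OF assms]])

lemma inj_on_line_rep: "inj_on line_rep lines"
proof (rule inj_onI)
  fix l l' :: "('a ^ 'b) set" assume l: "l \<in> lines" "l' \<in> lines" and "line_rep l = line_rep l'"
  then show "l = l'" using span_line_rep[OF l(1)] span_line_rep[OF l(2)] by (simp only:)
qed

lemma span_Union_lines:
  fixes L :: "('k::field ^ 'n) set set"
  assumes "L \<subseteq> lines"
  shows "vec.span (\<Union>L) = vec.span (line_rep ` L)"
proof (rule antisym)
  have "l \<subseteq> vec.span (line_rep ` L)" if "l \<in> L" for l
    using that assms span_line_rep[of l] vec.span_mono[of "{line_rep l}" "line_rep ` L"] by blast
  then show "vec.span (\<Union>L) \<subseteq> vec.span (line_rep ` L)"
    by (intro vec.span_minimal vec.subspace_span) blast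
  show "vec.span (line_rep ` L) \<subseteq> vec.span (\<Union>L)"
    by (rule vec.span_mono) (use assms line_rep(1) in blast)
qed

text \<open>The chosen vectors are distinct for distinct lines and have the same span as the lines,
  so the dimension condition becomes independence of these vectors. This carries the exchange
  property over from vectors to lines.\<close>

lemma K_complex_iff:
  fixes L :: "('k::{field,finite} ^ 'n) set set"
  shows "L \<in> K_complex \<longleftrightarrow> L \<subseteq> lines \<and> vec.independent (line_rep ` L)"
proof (cases "L \<subseteq> lines")
  case True
  have "card (line_rep ` L) = card L"
    by (rule card_image) (rule inj_on_subset[OF inj_on_line_rep True])
  moreover have "vec.independent (line_rep ` L) \<longleftrightarrow> card (line_rep ` L) = vec.dim (line_rep ` L)"
    using vec.card_eq_dim[of "line_rep ` L" "line_rep ` L"] vec.dim_eq_card_independent[of "line_rep ` L"]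
      vec.span_superset[of "line_rep ` L"] by auto
  moreover have "vec.dim (vec.span (\<Union>L)) = vec.dim (line_rep ` L)"
    unfolding span_Union_lines[OF True] by simp
  ultimately show ?thesis using True by (simp only: K_complex_def mem_Collect_eq finite) metis
qed (simp add: K_complex_def)

lemma card_line_rep: "L \<in> K_complex \<Longrightarrow> card (line_rep ` L) = card L"
  for L :: "('k::{field,finite} ^ 'n) set set"
  unfolding K_complex_def by (blast intro: card_image inj_on_subset[OF inj_on_line_rep])

lemma insert_K_complex_iff:
  fixes L :: "('k::{field,finite} ^ 'n) set set"
  assumes L: "L \<in> K_complex"
  shows "l \<notin> L \<and> insert l L \<in> K_complex \<longleftrightarrow> l \<in> lines \<and> line_rep l \<notin> vec.span (line_rep ` L)"
proof -
  have "line_rep l \<notin> line_rep ` L" if "l \<in> lines" "l \<notin> L"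
    using that L inj_on_line_rep unfolding K_complex_iff inj_on_def by blast
  then show ?thesis
    using L vec.span_base[of "line_rep l" "line_rep ` L"]
    unfolding K_complex_iff by (auto simp: vec.independent_insert)
qed

lemma matroid_K_complex: "matroid (K_complex :: ('k::{field,finite} ^ 'n) set set set) CARD('n)"
  unfolding matroid_def
proof (intro conjI ballI allI impI)
  fix L :: "('k ^ 'n) set set" assume L: "L \<in> K_complex"
  then show "card L \<le> CARD('n)"
    using vec.independent_card_le_dim[of "line_rep ` L" UNIV] card_line_rep[OF L]
    by (simp add: K_complex_iff card_cart_basis)
  show "L' \<in> K_complex" if "L' \<subseteq> L" for L'
  proof -
    have "vec.independent (line_rep ` L')"
      by (rule vec.independent_mono[OF _ image_mono[OF that]]) (use L in \<open>simp add: K_complex_iff\<close>)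
    then show ?thesis using L that unfolding K_complex_iff by blast
  qed
  show "\<exists>l\<in>L' - L. insert l L \<in> K_complex" if L': "L' \<in> K_complex" "card L < card L'" for L'
  proof -
    obtain x where "x \<in> line_rep ` L'" "x \<notin> vec.span (line_rep ` L)"
      using independent_exchange[of "line_rep ` L" "line_rep ` L'"] L L' card_line_rep
      by (metis K_complex_iff)
    then show ?thesis using insert_K_complex_iff[OF L] L'(1) unfolding K_complex_iff[of L'] by blast
  qed
next
  \<comment> \<open>The coordinate axes serve as a basis. There are at most \<open>CARD('n)\<close>
    of them as an image of the standard basis, and at least as many because they span the
    space.\<close>
  let ?L = "(\<lambda>v. vec.span {v}) ` (cart_basis :: ('k ^ 'n) set)"
  have B: "vec.independent (cart_basis :: ('k ^ 'n) set)" by (rule vec.independent_Basis)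
  then have zero: "0 \<notin> (cart_basis :: ('k ^ 'n) set)" using vec.dependent_zero by blast
  have L: "?L \<subseteq> lines"
  proof (rule image_subsetI)
    fix v :: "'k ^ 'n" assume "v \<in> cart_basis"
    then have "v \<noteq> 0" using zero by metis
    then show "vec.span {v} \<in> lines" by (rule span_singleton_lines)
  qed
  have "cart_basis \<subseteq> \<Union>?L"
  proof
    fix v :: "'k ^ 'n" assume "v \<in> cart_basis"
    moreover have "v \<in> vec.span {v}" by (rule vec.span_base) simp
    ultimately show "v \<in> \<Union>?L" by (rule UN_I)
  qed
  then have "vec.span cart_basis \<subseteq> vec.span (\<Union>?L)" by (rule vec.span_mono)
  then have "vec.span (\<Union>?L) = UNIV" unfolding vec.span_Basis by (rule top.extremum_uniqueI)
  then have dim: "vec.dim (vec.span (\<Union>?L)) = CARD('n)" by (simp only: vec_dim_card)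
  have "vec.dim (line_rep ` ?L) \<le> card (line_rep ` ?L)" by (rule vec.dim_le_card) (auto simp: vec.span_superset)
  also have "\<dots> \<le> card ?L" by (rule card_image_le) simp
  finally have "CARD('n) \<le> card ?L" using dim unfolding span_Union_lines[OF L] by simp
  moreover have "card ?L \<le> CARD('n)"
    using card_image_le[of "cart_basis :: ('k ^ 'n) set" "\<lambda>v. vec.span {v}"] by (simp add: card_cart_basis)
  ultimately have "card ?L = CARD('n)" by simp
  then show "\<exists>L\<in>K_complex :: ('k ^ 'n) set set set. card L = CARD('n)"
  proof -
    assume c: "card ?L = CARD('n)"
    then have "?L \<in> K_complex" using L dim by (simp only: K_complex_def mem_Collect_eq finite simp_thms)
    with c show ?thesis by (rule bexI)
  qed
qed simp_all

text \<open>The complement of the span is the disjoint union of the admissible lines without 0, and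
  each of these contributes \<open>CARD('k) - 1\<close> vectors.\<close>

lemma card_K_complex_extensions:
  fixes L :: "('k::{field,finite} ^ 'n) set set"
  assumes L: "L \<in> K_complex"
  shows "real (card {l. l \<notin> L \<and> insert l L \<in> K_complex}) =
    (real CARD('k) ^ CARD('n) - real CARD('k) ^ card L) / (real CARD('k) - 1)"
proof -
  let ?V = "vec.span (line_rep ` L)" and ?E = "{l. l \<notin> L \<and> insert l L \<in> K_complex}"
  have E: "l \<in> ?E \<longleftrightarrow> l \<in> lines \<and> line_rep l \<notin> ?V" for l
    using insert_K_complex_iff[OF L] by simp
  have ind: "vec.independent (line_rep ` L)" using L by (simp add: K_complex_iff)
  have cV: "card ?V = CARD('k) ^ card L" using card_span_independent[OF ind] card_line_rep[OF L] by simp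
  have same: "vec.span {v} = l" if "l \<in> lines" "v \<in> l - {0}" for v and l :: "('k ^ 'n) set"
    using lines_eq_span that by blast
  have "UNIV - ?V = (\<Union>l\<in>?E. l - {0})"
  proof (intro equalityI subsetI)
    fix v assume v: "v \<in> UNIV - ?V"
    then have "v \<noteq> 0" using vec.span_zero by blast
    then have l: "vec.span {v} \<in> lines" by (rule span_singleton_lines)
    have "line_rep (vec.span {v}) \<notin> ?V"
    proof
      assume "line_rep (vec.span {v}) \<in> ?V"
      then have "vec.span {line_rep (vec.span {v})} \<subseteq> ?V" by (intro vec.span_minimal) auto
      then show False using span_line_rep[OF l] v vec.span_base[of v "{v}"] by blast
    qed
    then show "v \<in> (\<Union>l\<in>?E. l - {0})" using l \<open>v \<noteq> 0\<close> vec.span_base[of v "{v}"] E by blast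
  next
    fix v assume "v \<in> (\<Union>l\<in>?E. l - {0})"
    then obtain l where l: "l \<in> lines" "line_rep l \<notin> ?V" "v \<in> l - {0}" using E by blast
    have "v \<notin> ?V"
    proof
      assume "v \<in> ?V"
      then have "vec.span {v} \<subseteq> ?V" by (intro vec.span_minimal) auto
      then show False using same[OF l(1,3)] line_rep(1)[OF l(1)] l(2) by blast
    qed
    then show "v \<in> UNIV - ?V" by blast
  qed
  moreover have "(l - {0}) \<inter> (l' - {0}) = {}" if "l \<in> ?E" "l' \<in> ?E" "l \<noteq> l'" for l l'
  proof (rule ccontr)
    assume "(l - {0}) \<inter> (l' - {0}) \<noteq> {}"
    then obtain v where "v \<in> l - {0}" "v \<in> l' - {0}" by blast
    moreover have "l \<in> lines" "l' \<in> lines" using E that by blast+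
    ultimately show False using same that(3) by metis
  qed
  then have "card (\<Union>l\<in>?E. l - {0}) = (\<Sum>l\<in>?E. card (l - {0}))"
    by (intro card_UN_disjoint) simp_all
  ultimately have "card (UNIV - ?V) = (\<Sum>l\<in>?E. card (l - {0}))" by (simp only:)
  also have "\<dots> = (\<Sum>l\<in>?E. CARD('k) - 1)"
  proof (rule sum.cong)
    fix l assume "l \<in> ?E"
    then have l: "l \<in> lines" using E by blast
    have "card l = CARD('k)"
      using card_span_independent[of "{line_rep l}"] span_line_rep[OF l] line_rep(2)[OF l] by simp
    moreover have "0 \<in> l" using l vec.subspace_0 by (auto simp: lines_def)
    ultimately show "card (l - {0}) = CARD('k) - 1" by simp
  qed simp
  also have "\<dots> = card ?E * (CARD('k) - 1)" by simp
  finally have eq: "card (UNIV - ?V) = card ?E * (CARD('k) - 1)" .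
  have "card (UNIV - ?V) = CARD('k) ^ CARD('n) - CARD('k) ^ card L"
    by (simp add: card_Diff_subset cV CARD_vec)
  moreover have "CARD('k) ^ card L \<le> CARD('k) ^ CARD('n)"
    using card_mono[of UNIV ?V] by (simp add: cV CARD_vec)
  \<comment> \<open>Makes the divisor \<open>CARD('k) - 1\<close> nonzero.\<close>
  moreover have k: "2 \<le> CARD('k)"
    using card_mono[of UNIV "{0, 1 :: 'k}"] by simp
  ultimately have "real CARD('k) ^ CARD('n) - real CARD('k) ^ card L = real (card ?E) * (real CARD('k) - 1)"
    using arg_cong[OF eq, of real] by (simp add: of_nat_diff)
  then show ?thesis using k by (simp add: field_simps)
qed

theorem proposition2p14:
  fixes p n :: nat
  assumes "p = CARD('p::prime_card)" and "n = CARD('n::finite)"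
  shows "(n \<ge> 1 \<longrightarrow>
            (\<exists>m. real m = A_number n p \<and>
               geometric_realization (X_complex :: ('p mod_ring ^ 'n) set set)
                 homotopy_equivalent_space wedge_of_spheres m (n - 1))) \<and>
         (n > 1 \<longrightarrow>
            (\<exists>m. real m = B_number n p \<and>
               geometric_realization (K_complex :: ('p mod_ring ^ 'n) set set set)
                 homotopy_equivalent_space wedge_of_spheres m (n - 1)))"
proof -
  have card: "CARD('p mod_ring) = p" using assms(1) by simp
  \<comment> \<open>Rank \<open>n\<close> means spheres of dimension \<open>n - 1\<close>; as the
    cardinality of a type, \<open>n\<close> is positive.\<close>
  have n: "n = Suc (n - 1)" using assms(2) by simp
  let ?X = "X_complex :: ('p mod_ring ^ 'n) set set" and ?K = "K_complex :: ('p mod_ring ^ 'n) set set set"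
  have mX: "matroid ?X n" and mK: "matroid ?K n"
    unfolding assms(2) by (rule matroid_X_complex matroid_K_complex)+
  have "(-1) ^ n * (\<Sum>s\<in>?X. (-1) ^ card s) = A_number n p"
    unfolding A_number_def
  proof (rule matroid_euler[OF mX])
    fix s assume "s \<in> ?X"
    then show "real (card {x. x \<notin> s \<and> insert x s \<in> ?X}) = real p ^ n - real p ^ card s"
      using card_X_complex_extensions[of s] by (simp only: card assms(2))
  qed
  moreover have "(-1) ^ n * (\<Sum>s\<in>?K. (-1) ^ card s) = B_number n p"
  proof -
    have "(-1) ^ n * (\<Sum>s\<in>?K. (-1) ^ card s) = (-1) ^ n + (\<Sum>i<n. (-1) ^ (n - 1 - i) *
        (\<Prod>j\<le>i. (real p ^ n - real p ^ j) / (real p - 1)) / fact (i + 1))"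
    proof (rule matroid_euler[OF mK])
      fix L assume "L \<in> ?K"
      then show "real (card {x. x \<notin> L \<and> insert x L \<in> ?K}) = (real p ^ n - real p ^ card L) / (real p - 1)"
        using card_K_complex_extensions[of L] by (simp only: card assms(2))
    qed
    also have "\<dots> = B_number n p"
      \<comment> \<open>The product of \<open>i + 1\<close> quotients collects the power
        \<open>(real p - 1) ^ (i + 1)\<close>.\<close>
      unfolding B_number_def by (simp add: prod_dividef mult.commute del: power_Suc)
    finally show ?thesis .
  qed
  ultimately show ?thesis
    using matroid_homotopy_equivalent_wedge[of ?X "n - 1"] matroid_homotopy_equivalent_wedge[of ?K "n - 1"]
      mX mK n by metis
qed

end
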